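(* Consider the uniform-controller branch (see context), and assume that each $F_i$ is twice continuously differentiable on $B(x_\star,R)$ and that there are constants $\mathcal H\ge0$, $M\ge0$ with, for all $i\in[n]$ and $x,y\in B(x_\star,R)$, $$\|\nabla^2F_i(x)-\nabla^2F(x)\|\le\mathcal H,\qquad \|\nabla^2F_i(x)-\nabla^2F_i(y)\|\le M\|x-y\|.$$ Define $K_{\mathrm{ho}}:=(\mathcal H+MR)^2$, $a_{\mathrm{ho}}:=\frac{\vartheta}{2LR^2}$, $\underline a_{\mathrm{ho}}:=\frac{\vartheta}{2LR^2(1+\vartheta/4)}$. Then, for every $t\ge0$, $$g_{t+1}\le T_{a_{\mathrm{ho}}}(g_t)+\frac{2\vartheta}{L}K_{\mathrm{ho}}\Delta_t^2+\frac{\vartheta^2}{2LnH}\frac{v^2}{b},\qquad \Delta_t^2:=\frac{96\vartheta^2}{L}g_t+\frac{32\vartheta^2v^2}{L^2Hb}+\frac{192\vartheta^2}{L^2}q_t.$$ Moreover, if $\bar q:=\max\bigl\{q_0,\frac{A_q+B_q\bar f}{1-C_q}\bigr\}$, then $q_t\le\bar q$ for all $t$, and therefore $$g_{t+1}\le g_t-\underline a_{\mathrm{ho}}g_t^2+\beta_{\mathrm{ho}}g_t+\delta_{\mathrm{ho}},$$ where $$\beta_{\mathrm{ho}}:=\frac{2\vartheta}{L}K_{\mathrm{ho}}\frac{96\vartheta^2}{L},\qquad \delta_{\mathrm{ho}}:=\frac{2\vartheta}{L}K_{\mathrm{ho}}\Bigl(\frac{32\vartheta^2v^2}{L^2Hb}+\frac{192\vartheta^2}{L^2}\bar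 q\Bigr)+\frac{\vartheta^2}{2LnH}\frac{v^2}{b}.$$ Consequently, for every integer $T\ge1$, $$\min_{0\le t\le T-1}g_t\le\frac{\beta_{\mathrm{ho}}}{\underline a_{\mathrm{ho}}}+\sqrt{\frac{\delta_{\mathrm{ho}}}{\underline a_{\mathrm{ho}}}}+\sqrt{\frac{g_0}{\underline a_{\mathrm{ho}}T}}.$$ In the homogeneous quadratic subcase $\mathcal H=0$, $M=0$, one has $K_{\mathrm{ho}}=0$ and therefore $$\min_{0\le t\le T-1}g_t\le C_1\sqrt{\frac{LR^2g_0}{\vartheta T}}+C_2Rv\sqrt{\frac{\vartheta}{nHb}}$$ for absolute constants $C_1,C_2>0$.
   Context: Problem: $F(x)=\frac1n\sum_{i=1}^nF_i(x)$, $F_i(x)=\frac1{m_i}\sum_{j=1}^{m_i}\phi_{ij}(x)$, each $\phi_{ij}:\mathbb R^d\to\mathbb R$ convex and $L$-smooth ($L$-Lipschitz gradient). There are $x_\star\in\arg\min F$ and $R>0$; $B(x_\star,R)=\{x:\|x-x_\star\|\le R\}$, $F_\star:=F(x_\star)$, $\bar f:=LR^2/2$. $v_i^2:=\sup_{x\in B(x_\star,R)}\frac1{m_i}\sum_j\|\nabla\phi_{ij}(x)-\nabla F_i(x)\|^2$, $v^2:=\max_iv_i^2$, $v\ge0$. Uniform-controller branch: all nodes are active in every round, with common horizon $H$, minibatch size $b$, amplitude $\vartheta\in(0,1]$ satisfying $288\vartheta^2<1$, and weights $1/n$. Concretely, $c_0=\frac1n\sum_ic_{i,0}$; in round $t\ge0$,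 each node $i\in[n]$ sets $\eta=\vartheta/(LH)$, $y_{i,t}^{(0)}=x_t$, and for $\ell=0,\dots,H-1$ draws a minibatch $\mathcal B_{i,t,\ell}\subseteq[m_i]$ of size $b$, computes $g_{i,t,\ell}=\frac1b\sum_{j\in\mathcal B_{i,t,\ell}}\nabla\phi_{ij}(y_{i,t}^{(\ell)})$ and sets $y_{i,t}^{(\ell+1)}=y_{i,t}^{(\ell)}-\eta(g_{i,t,\ell}-c_{i,t}+c_t)$; then $\Delta_{i,t}=y_{i,t}^{(H)}-x_t$, $c_{i,t+1}=c_{i,t}-c_t+\frac1{H\eta}(x_t-y_{i,t}^{(H)})$, $x_{t+1}=x_t+\frac1n\sum_i\Delta_{i,t}$, $c_{t+1}=c_t+\frac1n\sum_i(c_{i,t+1}-c_{i,t})$. Standing assumptions: almost surely $x_t,y_{i,t}^{(\ell)}\in B(x_\star,R)$ for all $t,i,\ell$. $\mathcal F_t$ is generated by the initial state and all minibatches drawn strictly before round $t$; $\mathcal G_{i,t,\ell}$ by $\mathcal F_t$ and all minibatches of node $i$ drawn strictly before local step $\ell$ of round $t$. Conditionally on $\mathcal G_{i,t,\ell}$ the minibatches are independent across nodes and local steps, $\mathbb E[g_{i,t,\ell}\mid\mathcal G_{i,t,\ell}]=\nabla F_i(y_{i,t}^{(\ell)})$ and $\mathbb E[\|g_{i,t,\ell}-\nabla F_i(y_{i,t}^{(\ell)})\|^2\mid\mathcal G_{i,t,\ell}]\le v_i^2/b$. Notation: $T_a(u):=\frac u{1+au}$ for $a,u\ge0$; $g_t:=\mathbb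 E[F(x_t)-F_\star]$; $e_{i,t}:=c_{i,t}-\nabla F_i(x_t)$; $q_t:=\max_i\mathbb E\|e_{i,t}\|^2$; $A_q:=6v^2/(Hb)$, $B_q:=144L\vartheta^2$, $C_q:=288\vartheta^2$. The scalar $\Delta_t^2$ in the claim is unrelated to the vectors $\Delta_{i,t}$. *)

theory Defs
  imports "HOL-Probability.Probability"
begin

definition grad :: "('a::euclidean_space \<Rightarrow> real) \<Rightarrow> 'a \<Rightarrow> 'a" where
  "grad f x = (THE D. GDERIV f x :> D)"

definition L_smooth :: "real \<Rightarrow> ('a::euclidean_space \<Rightarrow> real) \<Rightarrow> bool" where
  "L_smooth L f \<longleftrightarrow> (\<forall>x. GDERIV f x :> grad f x) \<and> L-lipschitz_on UNIV (grad f)"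

text \<open>The Hessian is the derivative of the gradient as a bounded linear map, so that its norm is the
  operator norm. The derivative is taken within the set, hence it is one-sided at boundary points;
  it is unique on closed balls of positive radius and agrees with the ordinary
  Hessian wherever the latter exists.\<close>

definition hess :: "'a::euclidean_space set \<Rightarrow> ('a \<Rightarrow> real) \<Rightarrow> 'a \<Rightarrow> 'a \<Rightarrow>\<^sub>L 'a" where
  "hess S f x = Blinfun (frechet_derivative (grad f) (at x within S))"

definition C2_on :: "'a::euclidean_space set \<Rightarrow> ('a \<Rightarrow> real) \<Rightarrow> bool" where
  "C2_on S f \<longleftrightarrow>
     (\<forall>x\<in>S. GDERIV f x :> grad f x) \<and> grad f differentiable_on S \<and> continuous_on S (hess S f)"

text \<open>Nodes are \<open>{..<n}\<close>, and the samples of node \<open>i\<close> are \<open>{..<m i}\<close>.\<close>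

definition node_obj :: "(nat \<Rightarrow> nat) \<Rightarrow> (nat \<Rightarrow> nat \<Rightarrow> 'a \<Rightarrow> real) \<Rightarrow> nat \<Rightarrow> 'a \<Rightarrow> real" where
  "node_obj m \<phi> i x = (1 / real (m i)) * (\<Sum>j<m i. \<phi> i j x)"

definition global_obj :: "nat \<Rightarrow> (nat \<Rightarrow> nat) \<Rightarrow> (nat \<Rightarrow> nat \<Rightarrow> 'a \<Rightarrow> real) \<Rightarrow> 'a \<Rightarrow> real" where
  "global_obj n m \<phi> x = (1 / real n) * (\<Sum>i<n. node_obj m \<phi> i x)"

definition node_var ::
  "(nat \<Rightarrow> nat) \<Rightarrow> (nat \<Rightarrow> nat \<Rightarrow> 'a::euclidean_space \<Rightarrow> real) \<Rightarrow> 'a \<Rightarrow> real \<Rightarrow> nat \<Rightarrow> real" where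
  "node_var m \<phi> xs R i = (SUP x\<in>cball xs R.
     (1 / real (m i)) * (\<Sum>j<m i. (norm (grad (\<phi> i j) x - grad (node_obj m \<phi> i) x))\<^sup>2))"

text \<open>The sigma-algebra generated by the initial state and all minibatches of rounds before \<open>t\<close>, and its
  extension by the minibatches of node \<open>i\<close> in round \<open>t\<close> before local step \<open>l\<close>.
  \<open>B i t l\<close> is the minibatch of node \<open>i\<close> in round \<open>t\<close> at local step \<open>l\<close>.\<close>

definition round_alg ::
  "'w measure \<Rightarrow> nat \<Rightarrow> nat \<Rightarrow> ('w \<Rightarrow> 'a::euclidean_space) \<Rightarrow> (nat \<Rightarrow> 'w \<Rightarrow> 'a) \<Rightarrow>
   (nat \<Rightarrow> nat \<Rightarrow> nat \<Rightarrow> 'w \<Rightarrow> nat set) \<Rightarrow> nat \<Rightarrow> 'w measure" where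
  "round_alg P n H x0 c0 B t = sigma (space P)
     (sets (vimage_algebra (space P) x0 borel)
      \<union> (\<Union>i<n. sets (vimage_algebra (space P) (c0 i) borel))
      \<union> (\<Union>s<t. \<Union>i<n. \<Union>l<H. sets (vimage_algebra (space P) (B i s l) (count_space UNIV))))"

definition local_alg ::
  "'w measure \<Rightarrow> nat \<Rightarrow> nat \<Rightarrow> ('w \<Rightarrow> 'a::euclidean_space) \<Rightarrow> (nat \<Rightarrow> 'w \<Rightarrow> 'a) \<Rightarrow>
   (nat \<Rightarrow> nat \<Rightarrow> nat \<Rightarrow> 'w \<Rightarrow> nat set) \<Rightarrow> nat \<Rightarrow> nat \<Rightarrow> nat \<Rightarrow> 'w measure" where
  "local_alg P n H x0 c0 B i t l = sigma (space P)
     (sets (round_alg P n H x0 c0 B t)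
      \<union> (\<Union>r<l. sets (vimage_algebra (space P) (B i t r) (count_space UNIV))))"

text \<open>Coordinatewise, since the library only has conditional expectations of scalar functions.\<close>

definition vec_cond_exp ::
  "'w measure \<Rightarrow> 'w measure \<Rightarrow> ('w \<Rightarrow> real ^ 'd) \<Rightarrow> 'w \<Rightarrow> real ^ 'd" where
  "vec_cond_exp P G X \<omega> = (\<chi> k. real_cond_exp P G (\<lambda>\<omega>. X \<omega> $ k) \<omega>)"

text \<open>Mutual conditional independence given \<open>G\<close>: the conditional analogue of \<open>indep_vars\<close>.\<close>

definition cond_indep_vars ::
  "'w measure \<Rightarrow> 'w measure \<Rightarrow> ('i \<Rightarrow> 'b measure) \<Rightarrow> ('i \<Rightarrow> 'w \<Rightarrow> 'b) \<Rightarrow> 'i set \<Rightarrow> bool" where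
  "cond_indep_vars P G N X I \<longleftrightarrow>
     (\<forall>i\<in>I. X i \<in> measurable P (N i)) \<and>
     (\<forall>J\<subseteq>I. J \<noteq> {} \<longrightarrow> finite J \<longrightarrow> (\<forall>A\<in>Pi J (\<lambda>j. sets (N j)).
        AE \<omega> in P. real_cond_exp P G (indicator (\<Inter>j\<in>J. X j -` A j \<inter> space P)) \<omega>
                 = (\<Prod>j\<in>J. real_cond_exp P G (indicator (X j -` A j \<inter> space P)) \<omega>)))"

definition T_map :: "real \<Rightarrow> real \<Rightarrow> real" where
  "T_map a u = u / (1 + a * u)"

text \<open>The two absolute constants of the homogeneous quadratic bound, fixed as numbers: an existential
  quantifier inside a theorem could still depend on its type variables, in particular
  on the dimension. The values bound \<open>2 * (1 + \<theta>/4)\<close> and \<open>1 + \<theta>/4\<close>, with \<open>\<theta> \<le> 1\<close>, under the roots.\<close>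

definition C1_abs :: real where "C1_abs = sqrt (5 / 2)"
definition C2_abs :: real where "C2_abs = sqrt (5 / 4)"

end

theory Submission
  imports Defs
begin

text \<open>Because the control variates cancel in the average over the nodes, the averaged local iterates
  \<open>ybar l = (1/n) (\<Sum>i. y i l)\<close> perform stochastic gradient descent on \<open>F\<close> with step size
  \<open>\<eta> = \<theta> / (L H)\<close>. Each step has a bias, the mean of the node gradients at the scattered points
  \<open>y i l\<close> minus the gradient of \<open>F\<close> at \<open>ybar l\<close>, and a noise of variance at most \<open>v\<^sup>2 / (n b)\<close>.

  One step. With gap \<open>u = E (F (ybar l) - F xs)\<close>, smoothness and convexity (on the ball, the gap is at
  most \<open>R\<close> times the gradient norm) give \<open>u' \<le> u - \<eta>/(2 R\<^sup>2) u\<^sup>2 + \<eta>/2 E (bias\<^sup>2) + L \<eta>\<^sup>2/2 v\<^sup>2/(n b)\<close>.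
  No cross term between bias and noise remains, because the noise of a local step is orthogonal
  to everything that depends on the past and on all the other minibatches of the round
  (\<open>noise_orthogonal\<close>). This is where conditional independence across the nodes
  enters (\<open>cond_indep_vars_orthogonal\<close>). The argument goes by local steps, since over a whole round the
  bias would depend on the noise of that round.

  One round. A quadratic decrease \<open>u - \<alpha> u\<^sup>2\<close> is at most \<open>T_map \<alpha> u\<close>, and the maps \<open>T_map \<alpha>\<close> are monotone,
  nonexpansive and satisfy \<open>T_map \<alpha> \<circ> T_map \<beta> = T_map (\<alpha> + \<beta>)\<close>. Hence the \<open>H\<close> local steps compose to
  \<open>T_map a\<close> while the errors merely add up (\<open>T_map_iterate\<close>, \<open>round_descent\<close>).

  The errors. In the bias one may subtract the Hessian of \<open>F\<close> at \<open>ybar l\<close> applied to the deviations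
  from the mean, which sum to zero. The mean value inequality then bounds the squared bias by \<open>4 K\<close> times
  the mean squared deviation of the \<open>y i l\<close> (\<open>averaging_bias\<close>), and this is controlled by the drift
  of the local iterates from \<open>x t\<close> (\<open>drift_bound\<close>). The drift in turn involves
  the control error \<open>q t\<close>, which satisfies an affine recursion with factor \<open>288 \<theta>\<^sup>2 < 1\<close> and
  therefore stays bounded (\<open>q_step\<close>, \<open>q_bounded\<close>).

  The bound on the minimum follows from the scalar recursion \<open>g' \<le> g - \<kappa> g\<^sup>2 + \<beta> g + \<delta>\<close>: as long as \<open>g\<close>
  exceeds the claimed value, it decreases by more than \<open>g 0 / T\<close> per round and would become negative
  after \<open>T\<close> rounds (\<open>Min_le_of_quadratic_recursion\<close>).\<close>

section \<open>Smooth convex functions\<close>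

lemma grad_eqI:
  assumes "GDERIV f x :> D"
  shows "grad f x = D"
  unfolding grad_def
proof (rule the_equality)
  fix D' assume "GDERIV f x :> D'"
  with assms have "(\<lambda>h. inner h D') = (\<lambda>h. inner h D)"
    unfolding gderiv_def by (rule has_derivative_unique[rotated])
  then show "D' = D"
    by (metis vector_eq_ldot)
qed (rule assms)

lemma GDERIV_sum:
  assumes "\<And>i. i \<in> I \<Longrightarrow> GDERIV (f i) x :> D i"
  shows "GDERIV (\<lambda>x. \<Sum>i\<in>I. f i x) x :> (\<Sum>i\<in>I. D i)"
  using assms unfolding gderiv_def inner_sum_right by (rule has_derivative_sum)

lemma GDERIV_average:
  assumes "\<And>i. i \<in> I \<Longrightarrow> L_smooth L (f i)"
  shows "GDERIV (\<lambda>x. k * (\<Sum>i\<in>I. f i x)) x :> k *\<^sub>R (\<Sum>i\<in>I. grad (f i) x)"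
proof -
  have "GDERIV (\<lambda>x. \<Sum>i\<in>I. f i x) x :> (\<Sum>i\<in>I. grad (f i) x)"
    using assms unfolding L_smooth_def by (intro GDERIV_sum) auto
  then show ?thesis
    using GDERIV_mult[OF GDERIV_const[of k x]] by fastforce
qed

lemma L_smooth_average:
  fixes f :: "'i \<Rightarrow> 'a::euclidean_space \<Rightarrow> real"
  assumes sm: "\<And>i. i \<in> I \<Longrightarrow> L_smooth L (f i)" and I: "finite I" "I \<noteq> {}"
  defines "h \<equiv> \<lambda>x. (1 / real (card I)) * (\<Sum>i\<in>I. f i x)"
  shows "grad h x = (1 / real (card I)) *\<^sub>R (\<Sum>i\<in>I. grad (f i) x)" and "L_smooth L h"
proof -
  have D: "GDERIV h x :> (1 / real (card I)) *\<^sub>R (\<Sum>i\<in>I. grad (f i) x)" for x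
    unfolding h_def by (rule GDERIV_average[OF sm])
  have g: "grad h x = (1 / real (card I)) *\<^sub>R (\<Sum>i\<in>I. grad (f i) x)" for x
    by (rule grad_eqI[OF D])
  show "grad h x = (1 / real (card I)) *\<^sub>R (\<Sum>i\<in>I. grad (f i) x)" by (rule g)
  have L: "L \<ge> 0" using I sm by (auto simp: L_smooth_def dest: lipschitz_on_nonneg)
  have lip: "dist (grad (f i) x) (grad (f i) y) \<le> L * dist x y" if "i \<in> I" for i x y
    using sm[OF that] by (auto simp: L_smooth_def dest: lipschitz_onD)
  have c: "real (card I) > 0" using I by (simp add: card_gt_0_iff)
  have "dist (grad h x) (grad h y) \<le> L * dist x y" for x y
  proof -
    have "norm (\<Sum>i\<in>I. grad (f i) x - grad (f i) y) \<le> (\<Sum>i\<in>I. L * dist x y)"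
      by (intro sum_norm_le) (use lip in \<open>auto simp: dist_norm\<close>)
    then show ?thesis
      using c by (simp add: g dist_norm sum_subtractf flip: scaleR_diff_right)
        (simp add: field_simps)
  qed
  then show "L_smooth L h"
    using D L by (auto simp: L_smooth_def g intro!: lipschitz_onI)
qed

lemma convex_on_average:
  assumes "\<And>i. i \<in> I \<Longrightarrow> convex_on UNIV (f i)" and "k \<ge> 0"
  shows "convex_on UNIV (\<lambda>x. k * (\<Sum>i\<in>I. f i x))"
proof -
  have "convex_on UNIV (\<lambda>x. \<Sum>i\<in>I. f i x)"
    using assms(1)
    by (induction I rule: infinite_finite_induct) (auto intro: convex_on_add simp: convex_on_const)
  then show ?thesis
    using assms(2) by (intro convex_on_cmul)
qed

lemma has_real_derivative_along_line:
  assumes "\<And>z. GDERIV f z :> grad f z"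
  shows "((\<lambda>s. f (x + s *\<^sub>R d)) has_real_derivative inner (grad f (x + s *\<^sub>R d)) d) (at s)"
proof -
  have l: "((\<lambda>s. x + s *\<^sub>R d) has_derivative (\<lambda>h. h *\<^sub>R d)) (at s)"
    by (auto intro!: derivative_eq_intros)
  have "(f has_derivative (\<lambda>h. inner h (grad f (x + s *\<^sub>R d)))) (at (x + s *\<^sub>R d))"
    using assms by (simp add: gderiv_def)
  from has_derivative_compose[OF l this] show ?thesis
    by (simp add: has_field_derivative_def mult_commute_abs inner_commute)
qed

lemma L_smooth_descent:
  assumes "L_smooth L f"
  shows "f y \<le> f x + inner (grad f x) (y - x) + L / 2 * (norm (y - x))\<^sup>2"
proof -
  define d where "d = y - x"
  define h where "h s = f (x + s *\<^sub>R d) - s * inner (grad f x) d - L / 2 * s\<^sup>2 * (norm d)\<^sup>2" for s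
  have G: "\<And>z. GDERIV f z :> grad f z" and lip: "L-lipschitz_on UNIV (grad f)"
    using assms by (auto simp: L_smooth_def)
  have D: "(h has_real_derivative
      inner (grad f (x + s *\<^sub>R d)) d - inner (grad f x) d - L * s * (norm d)\<^sup>2) (at s)" for s
    unfolding h_def
    by (rule derivative_eq_intros has_real_derivative_along_line[OF G] refl | simp)+
  have "h 1 \<le> h 0"
  proof (rule DERIV_nonpos_imp_nonincreasing[of 0 1 h])
    fix s :: real assume s: "0 \<le> s" "s \<le> 1"
    have "inner (grad f (x + s *\<^sub>R d) - grad f x) d
        \<le> norm (grad f (x + s *\<^sub>R d) - grad f x) * norm d"
      by (rule norm_cauchy_schwarz)
    also have "\<dots> \<le> (L * norm (s *\<^sub>R d)) * norm d"
      using lipschitz_onD[OF lip, of "x + s *\<^sub>R d" x] by (intro mult_right_mono) (auto simp: dist_norm)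
    also have "\<dots> = L * s * (norm d)\<^sup>2"
      using s by (simp add: power2_eq_square)
    finally show "\<exists>z. (h has_real_derivative z) (at s) \<and> z \<le> 0"
      using D by (intro exI[of _ "inner (grad f (x + s *\<^sub>R d)) d - inner (grad f x) d
        - L * s * (norm d)\<^sup>2"]) (auto simp: inner_diff_left)
  qed auto
  then show ?thesis by (simp add: h_def d_def)
qed

lemma convex_gradient_inequality:
  assumes "convex_on UNIV f" "\<And>z. GDERIV f z :> grad f z"
  shows "f x + inner (grad f x) (y - x) \<le> f y"
proof -
  have "convex_on UNIV (\<lambda>s. f (x + s *\<^sub>R (y - x)))"
  proof (intro convex_onI)
    fix t a b :: real assume t: "0 < t" "t < 1"
    have *: "x + ((1 - t) *\<^sub>R a + t *\<^sub>R b) *\<^sub>R (y - x)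
        = (1 - t) *\<^sub>R (x + a *\<^sub>R (y - x)) + t *\<^sub>R (x + b *\<^sub>R (y - x))"
      by (simp add: algebra_simps)
    show "f (x + ((1 - t) *\<^sub>R a + t *\<^sub>R b) *\<^sub>R (y - x))
        \<le> (1 - t) * f (x + a *\<^sub>R (y - x)) + t * f (x + b *\<^sub>R (y - x))"
      unfolding * using t by (intro convex_onD[OF assms(1)]) auto
  qed auto
  from convex_on_imp_above_tangent[OF this, of 0 1 "inner (grad f x) (y - x)"]
  show ?thesis
    using has_real_derivative_along_line[OF assms(2), of x "y - x" 0] by auto
qed

lemma
  assumes "L_smooth L f" "L > 0" and min: "\<And>y. f xs \<le> f y"
  shows norm_grad_le_gap: "(norm (grad f x))\<^sup>2 \<le> 2 * L * (f x - f xs)"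
    and grad_minimizer_eq_0: "grad f xs = 0"
proof -
  have *: "(norm (grad f x))\<^sup>2 \<le> 2 * L * (f x - f xs)" for x
  proof -
    have "f xs \<le> f (x - (1 / L) *\<^sub>R grad f x)" by (rule min)
    also have "\<dots> \<le> f x - (norm (grad f x))\<^sup>2 / (2 * L)"
      using L_smooth_descent[OF assms(1), of "x - (1 / L) *\<^sub>R grad f x" x] \<open>L > 0\<close>
      by (simp add: power2_norm_eq_inner[symmetric] power_divide field_simps power2_eq_square)
    finally show ?thesis using \<open>L > 0\<close> by (simp add: field_simps)
  qed
  show "(norm (grad f x))\<^sup>2 \<le> 2 * L * (f x - f xs)" by (rule *)
  show "grad f xs = 0" using *[of xs] by simp
qed

lemma hess_has_derivative:
  assumes "C2_on S f" "z \<in> S"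
  shows "(grad f has_derivative blinfun_apply (hess S f z)) (at z within S)"
proof -
  have "(grad f has_derivative frechet_derivative (grad f) (at z within S)) (at z within S)"
    using assms by (auto simp: C2_on_def differentiable_on_def frechet_derivative_works)
  then show ?thesis
    unfolding hess_def by (simp add: bounded_linear_Blinfun_apply has_derivative_bounded_linear)
qed

lemma gradient_linearization_bound:
  assumes "C2_on S f" "convex S" "u \<in> S" "w \<in> S"
    and "\<And>z. z \<in> S \<Longrightarrow> norm (hess S f z - Q) \<le> k"
  shows "norm (grad f u - grad f w - blinfun_apply Q (u - w)) \<le> k * norm (u - w)"
proof -
  have "norm ((grad f u - Q u) - (grad f w - Q w)) \<le> k * norm (u - w)"
  proof (rule differentiable_bound[OF \<open>convex S\<close> _ _ \<open>u \<in> S\<close> \<open>w \<in> S\<close>])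
    fix z assume z: "z \<in> S"
    show "((\<lambda>z. grad f z - Q z) has_derivative blinfun_apply (hess S f z - Q)) (at z within S)"
      unfolding minus_blinfun.rep_eq
      by (intro has_derivative_diff hess_has_derivative assms z
          bounded_linear_imp_has_derivative blinfun.bounded_linear_right)
    show "onorm (blinfun_apply (hess S f z - Q)) \<le> k"
      using assms(5)[OF z] by (simp add: norm_blinfun.rep_eq)
  qed
  then show ?thesis by (simp add: blinfun.diff_right algebra_simps)
qed

section \<open>Averages of vectors\<close>

lemma norm_sum_power2_le:
  fixes f :: "'i \<Rightarrow> 'a::real_normed_vector"
  shows "(norm (\<Sum>i\<in>I. f i))\<^sup>2 \<le> real (card I) * (\<Sum>i\<in>I. (norm (f i))\<^sup>2)"
proof -
  have "(norm (\<Sum>i\<in>I. f i))\<^sup>2 \<le> (\<Sum>i\<in>I. norm (f i))\<^sup>2"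
    by (intro power_mono norm_sum) auto
  also have "\<dots> \<le> real (card I) * (\<Sum>i\<in>I. (norm (f i))\<^sup>2)"
    using Cauchy_Schwarz_ineq_sum[of "\<lambda>_. 1" "\<lambda>i. norm (f i)" I] by simp
  finally show ?thesis .
qed

lemma norm_average_power2_le:
  fixes f :: "nat \<Rightarrow> 'a::real_normed_vector"
  shows "(norm ((1 / real n) *\<^sub>R (\<Sum>i<n. f i)))\<^sup>2 \<le> (1 / real n) * (\<Sum>i<n. (norm (f i))\<^sup>2)"
  using norm_sum_power2_le[of f "{..<n}"]
  by (cases "n = 0") (auto simp: power_mult_distrib power_divide field_simps power2_eq_square)

lemma average_const_le:
  fixes f :: "nat \<Rightarrow> real"
  assumes "n \<ge> 1" "\<And>i. i < n \<Longrightarrow> f i \<le> k"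
  shows "(1 / real n) * (\<Sum>i<n. f i) \<le> k"
  using sum_bounded_above[of "{..<n}" f k] assms by (simp add: field_simps)

lemma norm_add_power2_le:
  fixes u w :: "'a::real_normed_vector"
  shows "(norm (u + w))\<^sup>2 \<le> 2 * (norm u)\<^sup>2 + 2 * (norm w)\<^sup>2"
proof -
  have "(norm (u + w))\<^sup>2 \<le> (norm u + norm w)\<^sup>2"
    by (intro power_mono norm_triangle_ineq) auto
  also have "\<dots> \<le> 2 * (norm u)\<^sup>2 + 2 * (norm w)\<^sup>2"
    using zero_le_power2[of "norm u - norm w"] by (simp add: power2_sum power2_diff)
  finally show ?thesis .
qed

text \<open>The mean minimizes the sum of squared distances.\<close>

lemma sum_dist_average_le:
  fixes y :: "nat \<Rightarrow> 'a::real_inner"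
  assumes "n \<ge> 1"
  shows "(\<Sum>i<n. (norm (y i - (1 / real n) *\<^sub>R (\<Sum>k<n. y k)))\<^sup>2) \<le> (\<Sum>i<n. (norm (y i - x))\<^sup>2)"
proof -
  define a where "a = (1 / real n) *\<^sub>R (\<Sum>k<n. y k)"
  have z: "(\<Sum>i<n. y i - a) = 0"
    using assms by (simp add: a_def sum_subtractf sum_constant_scaleR)
  have "(norm (y i - x))\<^sup>2 = (norm (y i - a))\<^sup>2 + 2 * inner (y i - a) (a - x) + (norm (a - x))\<^sup>2" for i
    using dot_norm[of "y i - a" "a - x"] by simp
  then have "(\<Sum>i<n. (norm (y i - x))\<^sup>2)
      = (\<Sum>i<n. (norm (y i - a))\<^sup>2) + 2 * inner (\<Sum>i<n. y i - a) (a - x) + n * (norm (a - x))\<^sup>2"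
    by (simp add: sum.distrib inner_sum_left sum_distrib_left)
  then show ?thesis unfolding z by (simp add: a_def)
qed

lemma convex_average_mem:
  fixes y :: "nat \<Rightarrow> 'a::real_vector"
  assumes "convex S" "n \<ge> 1" "\<And>i. i < n \<Longrightarrow> y i \<in> S"
  shows "(1 / real n) *\<^sub>R (\<Sum>i<n. y i) \<in> S"
  using convex_sum[of "{..<n}" S "\<lambda>_. 1 / real n" y] assms by (simp add: scaleR_sum_right)

section \<open>Scalar recursions\<close>

lemma T_map_mono:
  assumes "a \<ge> 0" "0 \<le> u" "u \<le> w"
  shows "T_map a u \<le> T_map a w"
proof -
  have "1 + a * u > 0" "1 + a * w > 0" using assms by (simp_all add: add_pos_nonneg)
  then show ?thesis
    unfolding T_map_def using assms by (simp add: divide_simps algebra_simps)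
qed

lemma T_map_comp:
  assumes "a \<ge> 0" "b \<ge> 0" "u \<ge> 0"
  shows "T_map a (T_map b u) = T_map (a + b) u"
proof -
  have p: "1 + b * u > 0" using assms by (simp add: add_pos_nonneg)
  then have "1 + a * (u / (1 + b * u)) = (1 + (a + b) * u) / (1 + b * u)"
    by (simp add: field_simps)
  then show ?thesis unfolding T_map_def using p by simp
qed

lemma T_map_add_le:
  assumes "a \<ge> 0" "u \<ge> 0" "s \<ge> 0"
  shows "T_map a (u + s) \<le> T_map a u + s"
proof -
  have "(u + s) / (1 + a * (u + s)) \<le> u / (1 + a * u) + s / 1"
    unfolding add_divide_distrib using assms
    by (intro add_mono divide_left_mono mult_pos_pos) (auto simp: add_pos_nonneg algebra_simps)
  then show ?thesis by (simp add: T_map_def)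
qed

lemma quadratic_le_T_map:
  assumes "a \<ge> 0" "u \<ge> 0"
  shows "u - a * u\<^sup>2 \<le> T_map a u"
proof -
  have "(u - a * u\<^sup>2) * (1 + a * u) = u - a\<^sup>2 * u ^ 3"
    by (simp add: algebra_simps power2_eq_square power3_eq_cube)
  also have "\<dots> \<le> u" using assms by simp
  finally show ?thesis unfolding T_map_def using assms by (simp add: pos_le_divide_eq add_pos_nonneg)
qed

lemma T_map_le_quadratic:
  assumes "a \<ge> 0" "0 \<le> u" "a * u \<le> k"
  shows "T_map a u \<le> u - a / (1 + k) * u\<^sup>2"
proof -
  have p: "1 + a * u > 0" using assms by (simp add: add_pos_nonneg)
  have "T_map a u = u - a / (1 + a * u) * u\<^sup>2"
    unfolding T_map_def using p by (simp add: field_simps power2_eq_square)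
  also have "\<dots> \<le> u - a / (1 + k) * u\<^sup>2"
    using assms p by (intro diff_left_mono mult_right_mono divide_left_mono) (auto intro!: mult_pos_pos)
  finally show ?thesis .
qed

text \<open>The maps \<open>T_map a\<close> form a semigroup of monotone nonexpansive maps, so additive errors of
  the single steps merely add up.\<close>

lemma T_map_iterate:
  assumes "\<alpha> \<ge> 0" "s \<ge> 0" "\<And>l. l \<le> N \<Longrightarrow> u l \<ge> 0"
    and step: "\<And>l. l < N \<Longrightarrow> u (Suc l) \<le> u l - \<alpha> * (u l)\<^sup>2 + s"
  shows "l \<le> N \<Longrightarrow> u l \<le> T_map (real l * \<alpha>) (u 0) + real l * s"
proof (induction l)
  case 0
  then show ?case by (simp add: T_map_def)
next
  case (Suc l)
  have u0: "u 0 \<ge> 0" "u l \<ge> 0" using assms(3) Suc by auto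
  have T0: "T_map (real l * \<alpha>) (u 0) \<ge> 0" using u0 assms(1) by (simp add: T_map_def)
  have "u (Suc l) \<le> T_map \<alpha> (u l) + s"
    using step[of l] Suc quadratic_le_T_map[OF assms(1) u0(2)] by auto
  also have "\<dots> \<le> T_map \<alpha> (T_map (real l * \<alpha>) (u 0) + real l * s) + s"
    using Suc u0 assms(1) by (intro add_right_mono T_map_mono) auto
  also have "\<dots> \<le> T_map \<alpha> (T_map (real l * \<alpha>) (u 0)) + real l * s + s"
    using T0 assms by (intro add_right_mono T_map_add_le) auto
  also have "\<dots> = T_map (real (Suc l) * \<alpha>) (u 0) + real (Suc l) * s"
    using u0 assms by (subst T_map_comp) (auto simp: algebra_simps)
  finally show ?case .
qed

lemma Min_le_of_quadratic_recursion:
  fixes g :: "nat \<Rightarrow> real"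
  assumes "\<kappa> > 0" "\<beta> \<ge> 0" "\<delta> \<ge> 0" "N \<ge> 1" and nn: "\<And>t. g t \<ge> 0"
    and step: "\<And>t. g (Suc t) \<le> g t - \<kappa> * (g t)\<^sup>2 + \<beta> * g t + \<delta>"
  shows "(MIN t\<in>{..<N}. g t) \<le> \<beta> / \<kappa> + sqrt (\<delta> / \<kappa>) + sqrt (g 0 / (\<kappa> * real N))"
proof (rule ccontr)
  define s where "s = sqrt (\<delta> / \<kappa>) + sqrt (g 0 / (\<kappa> * real N))"
  assume "\<not> ?thesis"
  then have "\<beta> / \<kappa> + s < (MIN t\<in>{..<N}. g t)" by (simp add: s_def)
  then have big: "\<beta> / \<kappa> + s < g t" if "t < N" for t
    using that assms(4) by (subst (asm) Min_gr_iff) auto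
  have s0: "s \<ge> 0" using assms nn by (simp add: s_def)
  have "\<delta> / \<kappa> + g 0 / (\<kappa> * real N) \<le> s\<^sup>2"
    using assms nn[of 0] by (simp add: s_def power2_sum)
  then have s2: "\<delta> + g 0 / real N \<le> \<kappa> * s\<^sup>2"
    using assms by (simp add: field_simps)
  have dec: "g (Suc t) < g t - g 0 / real N" if t: "t < N" for t
  proof -
    have w: "s < g t - \<beta> / \<kappa>" "g t - \<beta> / \<kappa> \<le> g t" using big[OF t] assms by auto
    have "\<kappa> * s\<^sup>2 < \<kappa> * (g t - \<beta> / \<kappa>)\<^sup>2"
      using w s0 assms by (intro mult_strict_left_mono power_strict_mono) auto
    also have "\<dots> \<le> \<kappa> * (g t * (g t - \<beta> / \<kappa>))"
      unfolding power2_eq_square using w s0 assms by (intro mult_left_mono mult_right_mono) auto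
    also have "\<dots> = \<kappa> * (g t)\<^sup>2 - \<beta> * g t"
      using assms by (simp add: field_simps power2_eq_square)
    finally show ?thesis using step[of t] s2 by linarith
  qed
  have "t \<ge> 1 \<Longrightarrow> t \<le> N \<Longrightarrow> g t < g 0 - real t * (g 0 / real N)" for t
  proof (induction t)
    case (Suc t)
    then show ?case using dec[of t] by (cases "t = 0") (auto simp: distrib_right add_divide_distrib)
  qed simp
  from this[of N] have "g N < 0" using assms(4) by simp
  then show False using nn[of N] by simp
qed

lemma affine_recursion_bounded:
  fixes q :: "nat \<Rightarrow> real"
  assumes "\<And>t. q (Suc t) \<le> k + r * q t" "0 \<le> r" "r < 1"
  shows "q t \<le> max (q 0) (k / (1 - r))"
proof (induction t)
  case (Suc t)
  define Q where "Q = max (q 0) (k / (1 - r))"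
  have "k / (1 - r) \<le> Q" by (simp add: Q_def)
  then have "k + r * Q \<le> Q" using assms(3) by (simp add: pos_divide_le_eq algebra_simps)
  moreover have "r * q t \<le> r * Q" using Suc assms(2) unfolding Q_def by (intro mult_left_mono)
  ultimately show ?case using assms(1)[of t] unfolding Q_def by linarith
qed simp

section \<open>Orthogonality from conditional independence\<close>

lemma set_integral_eq_0_generator:
  fixes h :: "'w \<Rightarrow> real"
  assumes h: "integrable M h" and G: "Int_stable G" "G \<subseteq> sets M" "space M \<in> G"
    and zero: "\<And>A. A \<in> G \<Longrightarrow> (LINT \<omega>:A|M. h \<omega>) = 0"
    and A: "A \<in> sigma_sets (space M) G"
  shows "(LINT \<omega>:A|M. h \<omega>) = 0"
proof -
  have sub: "sigma_sets (space M) G \<subseteq> sets M"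
    using G(2) by (rule sets.sigma_sets_subset)
  have si: "set_integrable M C h" if "C \<in> sets M" for C
    unfolding set_integrable_def using that h by (rule integrable_mult_indicator)
  have "G \<subseteq> Pow (space M)" using G(2) sets.space_closed by blast
  from G(1) this A show ?thesis
  proof (induction rule: sigma_sets_induct_disjoint)
    case (basic A)
    then show ?case by (rule zero)
  next
    case (compl A)
    have AM: "A \<in> sets M" using compl sub by auto
    have "(LINT \<omega>:space M|M. h \<omega>) = (LINT \<omega>:A \<union> (space M - A)|M. h \<omega>)"
      using sets.sets_into_space[OF AM] by (intro arg_cong2[where f = "\<lambda>B. set_lebesgue_integral M B"]) auto
    also have "\<dots> = (LINT \<omega>:A|M. h \<omega>) + (LINT \<omega>:space M - A|M. h \<omega>)"
      using AM by (intro set_integral_Un si) auto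
    finally show ?case using compl zero[OF G(3)] by simp
  next
    case (union A)
    then have "A i \<in> sets M" for i using sub by auto
    then have "(LINT \<omega>:(\<Union>i. A i)|M. h \<omega>) = (\<Sum>i. LINT \<omega>:A i|M. h \<omega>)"
      using union(1) by (intro lebesgue_integral_countable_add si) (auto simp: disjoint_family_on_def)
    then show ?case using union by simp
  qed (simp add: set_lebesgue_integral_def)
qed

text \<open>The sigma-algebra \<open>G\<close> enlarged by the random variables \<open>X j\<close>, \<open>j \<in> J\<close>.\<close>

definition adjoin ::
  "'w measure \<Rightarrow> 'w measure \<Rightarrow> ('i \<Rightarrow> 'b measure) \<Rightarrow> ('i \<Rightarrow> 'w \<Rightarrow> 'b) \<Rightarrow> 'i set \<Rightarrow> 'w measure" where
  "adjoin P G N X J =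
     sigma (space P) (sets G \<union> (\<Union>j\<in>J. sets (vimage_algebra (space P) (X j) (N j))))"

lemma space_adjoin [simp]: "space (adjoin P G N X J) = space P"
  by (simp add: adjoin_def space_measure_of_conv)

lemma sets_adjoin:
  assumes "subalgebra P G"
  shows "sets (adjoin P G N X J) =
    sigma_sets (space P) (sets G \<union> (\<Union>j\<in>J. sets (vimage_algebra (space P) (X j) (N j))))"
  unfolding adjoin_def
proof (rule sets_measure_of)
  have "sets G \<subseteq> Pow (space P)" using assms sets.space_closed[of G] by (auto simp: subalgebra_def)
  moreover have "sets (vimage_algebra (space P) (X j) (N j)) \<subseteq> Pow (space P)" for j
    using sets.space_closed[of "vimage_algebra (space P) (X j) (N j)"] by simp
  ultimately show "sets G \<union> (\<Union>j\<in>J. sets (vimage_algebra (space P) (X j) (N j))) \<subseteq> Pow (space P)"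
    by blast
qed

lemma subalgebra_adjoin:
  assumes "subalgebra P G" "\<And>j. j \<in> J \<Longrightarrow> X j \<in> measurable P (N j)"
  shows "subalgebra P (adjoin P G N X J)"
proof -
  have "sets (vimage_algebra (space P) (X j) (N j)) \<subseteq> sets P" if "j \<in> J" for j
    using assms(2)[OF that] by (auto simp: sets_vimage_algebra2 measurable_def)
  then have "sets (adjoin P G N X J) \<subseteq> sets P"
    unfolding sets_adjoin[OF assms(1)]
    using assms(1) by (intro sets.sigma_sets_subset) (auto simp: subalgebra_def)
  then show ?thesis by (simp add: subalgebra_def)
qed

text \<open>A pi-system that generates \<open>adjoin P G N X J\<close>.\<close>

lemma adjoin_generator:
  assumes sub: "subalgebra P G" and X: "\<And>j. j \<in> J \<Longrightarrow> X j \<in> measurable P (N j)" and J: "finite J"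
  defines "\<E> \<equiv> {A \<inter> (\<Inter>j\<in>J. X j -` T j) |A T. A \<in> sets G \<and> T \<in> Pi J (\<lambda>j. sets (N j))}"
  shows "Int_stable \<E>" "\<E> \<subseteq> sets P" "space P \<in> \<E>"
    "sets (adjoin P G N X J) \<subseteq> sigma_sets (space P) \<E>"
proof -
  have sp: "space G = space P" "sets G \<subseteq> sets P" using sub by (auto simp: subalgebra_def)
  have I: "A \<inter> (\<Inter>j\<in>J. X j -` T j) \<in> \<E>" if "A \<in> sets G" "T \<in> Pi J (\<lambda>j. sets (N j))" for A T
    using that unfolding \<E>_def by blast
  have full: "A \<inter> (\<Inter>j\<in>J. X j -` space (N j)) = A" if "A \<subseteq> space P" for A
    using that measurable_space[OF X] by blast
  show "Int_stable \<E>"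
  proof (rule Int_stableI)
    fix a b assume "a \<in> \<E>" "b \<in> \<E>"
    then obtain A T A' T' where *: "a = A \<inter> (\<Inter>j\<in>J. X j -` T j)" "A \<in> sets G" "T \<in> Pi J (\<lambda>j. sets (N j))"
      "b = A' \<inter> (\<Inter>j\<in>J. X j -` T' j)" "A' \<in> sets G" "T' \<in> Pi J (\<lambda>j. sets (N j))"
      unfolding \<E>_def by blast
    have "a \<inter> b = (A \<inter> A') \<inter> (\<Inter>j\<in>J. X j -` (T j \<inter> T' j))" using * by blast
    also have "\<dots> \<in> \<E>" by (rule I) (use * in auto)
    finally show "a \<inter> b \<in> \<E>" .
  qed
  show "\<E> \<subseteq> sets P"
  proof
    fix a assume "a \<in> \<E>"
    then obtain A T where *: "a = A \<inter> (\<Inter>j\<in>J. X j -` T j)" "A \<in> sets G" "T \<in> Pi J (\<lambda>j. sets (N j))"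
      unfolding \<E>_def by blast
    have AP: "A \<in> sets P" using *(2) sp by auto
    have "a = A \<inter> (\<Inter>j\<in>J. A \<inter> X j -` T j)" using * by blast
    moreover have "A \<inter> X j -` T j \<in> sets P" if "j \<in> J" for j
    proof -
      have "A \<inter> X j -` T j = A \<inter> (X j -` T j \<inter> space P)" using sets.sets_into_space[OF AP] by blast
      also have "\<dots> \<in> sets P"
        using that *(3) AP X by (intro sets.Int measurable_sets[OF X]) auto
      finally show ?thesis .
    qed
    then have "A \<inter> (\<Inter>j\<in>J. A \<inter> X j -` T j) \<in> sets P"
      using AP J by (cases "J = {}") (auto simp del: INT_simps intro: sets.finite_INT)
    ultimately show "a \<in> sets P" by simp
  qed
  have G\<E>: "A \<in> \<E>" if "A \<in> sets G" for A
    using I[OF that, of "\<lambda>j. space (N j)"] full[of A] sets.sets_into_space[OF that] sp by simp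
  show "space P \<in> \<E>" using G\<E>[OF sets.top] sp by simp
  show "sets (adjoin P G N X J) \<subseteq> sigma_sets (space P) \<E>"
    unfolding sets_adjoin[OF sub]
  proof (rule sigma_sets_mono', safe)
    fix A assume "A \<in> sets G" then show "A \<in> \<E>" by (rule G\<E>)
  next
    fix j A assume j: "j \<in> J" and A: "A \<in> sets (vimage_algebra (space P) (X j) (N j))"
    then obtain T where T: "A = X j -` T \<inter> space P" "T \<in> sets (N j)"
      using X[OF j] by (auto simp: sets_vimage_algebra2 measurable_def)
    have "A = space P \<inter> (\<Inter>k\<in>J. X k -` (if k = j then T else space (N k)))"
      using T j measurable_space[OF X] by (auto split: if_splits)
    also have "\<dots> \<in> \<E>" using T sp sets.top[of G] by (intro I) auto
    finally show "A \<in> \<E>" .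
  qed
qed

lemma measurable_adjoin_base:
  assumes "subalgebra P G" "h \<in> measurable G K"
  shows "h \<in> measurable (adjoin P G N X J) K"
  using assms(2)
  by (rule measurable_from_subalg[rotated])
    (use assms(1) in \<open>auto simp: subalgebra_def sets_adjoin[OF assms(1)] intro: sigma_sets.Basic\<close>)

lemma measurable_adjoin_var:
  assumes "subalgebra P G" "j \<in> J" "X j \<in> measurable P (N j)"
  shows "X j \<in> measurable (adjoin P G N X J) (N j)"
proof (rule measurableI)
  fix A assume "A \<in> sets (N j)"
  then have "X j -` A \<inter> space P \<in> sets (vimage_algebra (space P) (X j) (N j))"
    by (rule in_vimage_algebra)
  then show "X j -` A \<inter> space (adjoin P G N X J) \<in> sets (adjoin P G N X J)"
    unfolding sets_adjoin[OF assms(1)] space_adjoin using assms(2)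
    by (intro sigma_sets.Basic) blast
qed (use measurable_space[OF assms(3)] in simp)

lemma sets_adjoin_least:
  assumes "subalgebra P G" "space Q = space P" "sets G \<subseteq> sets Q"
    "\<And>j. j \<in> J \<Longrightarrow> X j \<in> measurable Q (N j)"
  shows "subalgebra Q (adjoin P G N X J)"
proof -
  have "sets (vimage_algebra (space P) (X j) (N j)) \<subseteq> sets Q" if "j \<in> J" for j
    using assms(4)[OF that] by (intro sets_image_in_sets assms(2))
  then have "sigma_sets (space Q) (sets G \<union> (\<Union>j\<in>J. sets (vimage_algebra (space P) (X j) (N j)))) \<subseteq> sets Q"
    using assms(3) by (intro sets.sigma_sets_subset) blast
  then show ?thesis
    using assms(2) by (simp add: subalgebra_def sets_adjoin[OF assms(1)])
qed

lemma subalgebra_adjoin_base: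
  assumes "subalgebra P G"
  shows "subalgebra (adjoin P G N X J) G"
  using assms by (auto simp: subalgebra_def sets_adjoin[OF assms] intro: sigma_sets.Basic)

lemma (in prob_space) integral_norm_sum_orthogonal:
  fixes Z :: "'i \<Rightarrow> 'a \<Rightarrow> 'b::real_inner"
  assumes I: "finite I" and int: "\<And>i j. i \<in> I \<Longrightarrow> j \<in> I \<Longrightarrow> integrable M (\<lambda>\<omega>. inner (Z i \<omega>) (Z j \<omega>))"
    and orth: "\<And>i j. i \<in> I \<Longrightarrow> j \<in> I \<Longrightarrow> i \<noteq> j \<Longrightarrow> (\<integral>\<omega>. inner (Z i \<omega>) (Z j \<omega>) \<partial>M) = 0"
  shows "(\<integral>\<omega>. (norm (\<Sum>i\<in>I. Z i \<omega>))\<^sup>2 \<partial>M) = (\<Sum>i\<in>I. \<integral>\<omega>. (norm (Z i \<omega>))\<^sup>2 \<partial>M)"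
proof -
  have "(\<integral>\<omega>. (norm (\<Sum>i\<in>I. Z i \<omega>))\<^sup>2 \<partial>M) = (\<integral>\<omega>. (\<Sum>i\<in>I. \<Sum>j\<in>I. inner (Z i \<omega>) (Z j \<omega>)) \<partial>M)"
    unfolding power2_norm_eq_inner inner_sum_left by (simp only: inner_sum_right)
  also have "\<dots> = (\<Sum>i\<in>I. \<Sum>j\<in>I. \<integral>\<omega>. inner (Z i \<omega>) (Z j \<omega>) \<partial>M)"
    by (simp add: int)
  also have "\<dots> = (\<Sum>i\<in>I. \<Sum>j\<in>I. if j = i then \<integral>\<omega>. (norm (Z i \<omega>))\<^sup>2 \<partial>M else 0)"
    by (intro sum.cong refl) (auto simp: orth power2_norm_eq_inner)
  also have "\<dots> = (\<Sum>i\<in>I. \<integral>\<omega>. (norm (Z i \<omega>))\<^sup>2 \<partial>M)"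
    using I by simp
  finally show ?thesis .
qed

text \<open>If the family \<open>X\<close> is independent given \<open>G\<close>, then a variable that is determined by \<open>G\<close> and \<open>X i\<close>
  and has conditional mean zero given \<open>G\<close> is orthogonal to whatever is determined by \<open>G\<close> and the
  remaining members of the family: given \<open>G\<close>, the latter carry no information on \<open>X i\<close>.\<close>

lemma (in prob_space) cond_indep_vars_orthogonal:
  fixes f W :: "'a \<Rightarrow> real"
  assumes sub: "subalgebra M G" and ind: "cond_indep_vars M G N X I" and I: "finite I" "i \<in> I"
    and f: "integrable M f" "f \<in> borel_measurable (adjoin M G N X {i})"
    and zero: "AE \<omega> in M. real_cond_exp M G f \<omega> = 0"
    and W: "W \<in> borel_measurable (adjoin M G N X (I - {i}))" "integrable M (\<lambda>\<omega>. W \<omega> * f \<omega>)"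
  shows "(\<integral>\<omega>. W \<omega> * f \<omega> \<partial>M) = 0"
proof -
  define J where "J = I - {i}"
  define Gi where "Gi = adjoin M G N X {i}"
  define GJ where "GJ = adjoin M G N X J"
  have X: "\<And>j. j \<in> I \<Longrightarrow> X j \<in> measurable M (N j)" using ind by (simp add: cond_indep_vars_def)
  note indD = ind[unfolded cond_indep_vars_def, THEN conjunct2, rule_format]
  have J: "finite J" "J \<subseteq> I" "insert i J = I" "i \<notin> J" using I by (auto simp: J_def)
  have subi: "subalgebra M Gi" unfolding Gi_def using I X by (intro subalgebra_adjoin sub) auto
  have subJ: "subalgebra M GJ" unfolding GJ_def using J X by (intro subalgebra_adjoin sub) auto
  interpret G: finite_measure_subalgebra M G by standard (rule sub)
  interpret Gi: finite_measure_subalgebra M Gi by standard (rule subi)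
  interpret GJ: finite_measure_subalgebra M GJ by standard (rule subJ)
  have inP: "A \<in> sets M" if "A \<in> sets G" for A using that sub by (auto simp: subalgebra_def)
  have inGi: "A \<in> sets Gi" if "A \<in> sets G" for A
    using that unfolding Gi_def sets_adjoin[OF sub] by (auto intro: sigma_sets.Basic)
  have GGi: "h \<in> borel_measurable Gi" if "h \<in> borel_measurable G" for h :: "'a \<Rightarrow> real"
    using that inGi sub by (intro measurable_from_subalg[of Gi G]) (auto simp: subalgebra_def Gi_def)
  have [measurable]: "f \<in> borel_measurable M" using f by auto
  have iI: "integrable M (indicator S :: 'a \<Rightarrow> real)" if "S \<in> sets M" for S
    using that by (intro integrable_const_bound[where B = 1]) auto
  \<comment> \<open>given \<open>G\<close>, also knowing \<open>X i\<close> does not change the probability of an event about the others\<close>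
  have ce: "AE \<omega> in M. real_cond_exp M Gi (indicator E) \<omega> = real_cond_exp M G (indicator E) \<omega>"
    if T: "T \<in> Pi J (\<lambda>j. sets (N j))" and E_def: "E = (\<Inter>j\<in>J. X j -` T j) \<inter> space M" for T E
  proof -
    have E[measurable]: "E \<in> sets M"
    proof (cases "J = {}")
      case False
      have "E = (\<Inter>j\<in>J. X j -` T j \<inter> space M)" using False by (auto simp: E_def)
      also have "\<dots> \<in> sets M"
        using J False T by (intro sets.finite_INT measurable_sets[OF X]) auto
      finally show ?thesis .
    qed (simp add: E_def)
    define p where "p = real_cond_exp M G (indicator E)"
    have pG: "p \<in> borel_measurable G" by (simp add: p_def)
    have ip: "integrable M p" unfolding p_def by (intro G.real_cond_exp_int iI E)
    define h where "h \<omega> = indicator E \<omega> - p \<omega>" for \<omega>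
    have ih: "integrable M h" unfolding h_def by (intro Bochner_Integration.integrable_diff iI E ip)
    define \<E> where "\<E> = {A \<inter> (\<Inter>j\<in>{i}. X j -` T j) |A T. A \<in> sets G \<and> T \<in> Pi {i} (\<lambda>j. sets (N j))}"
    have gen: "Int_stable \<E>" "\<E> \<subseteq> sets M" "space M \<in> \<E>" "sets Gi \<subseteq> sigma_sets (space M) \<E>"
      unfolding \<E>_def Gi_def using I X by (intro adjoin_generator sub; auto)+
    have prodE: "AE \<omega> in M. real_cond_exp M G (indicator (E \<inter> (X i -` S \<inter> space M))) \<omega>
        = p \<omega> * real_cond_exp M G (indicator (X i -` S \<inter> space M)) \<omega>" if S: "S \<in> sets (N i)" for S
    proof (cases "J = {}")
      case True
      have ES: "E = space M" "E \<inter> (X i -` S \<inter> space M) = X i -` S \<inter> space M"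
        using True by (auto simp: E_def)
      have "AE \<omega> in M. p \<omega> = indicator E \<omega>"
        unfolding p_def using True sub sets.top[of G]
        by (intro G.real_cond_exp_F_meas iI E) (auto simp: E_def subalgebra_def)
      with AE_space show ?thesis
        unfolding ES(2) by eventually_elim (simp add: ES(1))
    next
      case False
      have A: "(\<lambda>j. if j = i then S else T j) \<in> Pi I (\<lambda>j. sets (N j))"
        using T S J by (auto simp: Pi_iff)
      have EJ: "(\<Inter>j\<in>J. X j -` T j \<inter> space M) = E" using False by (auto simp: E_def)
      have EI: "(\<Inter>j\<in>I. X j -` (if j = i then S else T j) \<inter> space M) = E \<inter> (X i -` S \<inter> space M)"
      proof -
        have "(\<Inter>j\<in>J. X j -` (if j = i then S else T j) \<inter> space M) = (\<Inter>j\<in>J. X j -` T j \<inter> space M)"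
          using J(4) by (intro INF_cong) auto
        then show ?thesis
          unfolding J(3)[symmetric] INT_insert EJ by auto
      qed
      have "(\<Prod>j\<in>J. real_cond_exp M G (indicator (X j -` (if j = i then S else T j) \<inter> space M)) \<omega>)
          = (\<Prod>j\<in>J. real_cond_exp M G (indicator (X j -` T j \<inter> space M)) \<omega>)" for \<omega>
        using J by (intro prod.cong) auto
      then have pI: "(\<Prod>j\<in>I. real_cond_exp M G (indicator (X j -` (if j = i then S else T j) \<inter> space M)) \<omega>)
         = real_cond_exp M G (indicator (X i -` S \<inter> space M)) \<omega>
           * (\<Prod>j\<in>J. real_cond_exp M G (indicator (X j -` T j \<inter> space M)) \<omega>)" for \<omega>
        unfolding J(3)[symmetric] using J(1,4) by simp
      have "AE \<omega> in M. real_cond_exp M G (indicator (\<Inter>j\<in>J. X j -` T j \<inter> space M)) \<omega>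
          = (\<Prod>j\<in>J. real_cond_exp M G (indicator (X j -` T j \<inter> space M)) \<omega>)"
        by (rule indD[OF J(2) False J(1) T])
      moreover have "AE \<omega> in M. real_cond_exp M G
            (indicator (\<Inter>j\<in>I. X j -` (if j = i then S else T j) \<inter> space M)) \<omega>
          = (\<Prod>j\<in>I. real_cond_exp M G (indicator (X j -` (if j = i then S else T j) \<inter> space M)) \<omega>)"
        using I by (intro indD A) auto
      ultimately show ?thesis
        unfolding EJ EI pI by eventually_elim (simp add: p_def)
    qed
    have "(LINT \<omega>:C|M. h \<omega>) = 0" if C: "C \<in> sigma_sets (space M) \<E>" for C
    proof (rule set_integral_eq_0_generator[OF ih gen(1-3) _ C])
      fix C assume "C \<in> \<E>"
      then obtain A S where C: "C = A \<inter> X i -` S" and A: "A \<in> sets G" and S: "S \<in> sets (N i)"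
        unfolding \<E>_def by auto
      define Y where "Y = X i -` S \<inter> space M"
      have Y[measurable]: "Y \<in> sets M" unfolding Y_def using S X I by (intro measurable_sets[OF X])
      have AM[measurable]: "A \<in> sets M" using A by (rule inP)
      have iA: "indicator C \<omega> = indicator A \<omega> * (indicator Y \<omega> :: real)" for \<omega>
        using sets.sets_into_space[OF AM] by (auto simp: C Y_def indicator_def)
      have mG: "(indicator A :: 'a \<Rightarrow> real) \<in> borel_measurable G" "p \<in> borel_measurable G"
        using A pG by simp_all
      have i1: "integrable M (\<lambda>\<omega>. indicator A \<omega> * (indicator Y \<omega> * p \<omega>))"
        using integrable_real_mult_indicator[OF AM integrable_real_mult_indicator[OF Y ip]]
        by (simp add: mult_ac)
      have i0: "integrable M (\<lambda>\<omega>. indicator A \<omega> * (indicator (E \<inter> Y) \<omega> :: real))"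
        using integrable_mult_indicator[OF AM iI[of "E \<inter> Y"]] by simp
      have "(\<integral>\<omega>. indicator A \<omega> * (indicator (E \<inter> Y) \<omega>) \<partial>M)
          = (\<integral>\<omega>. indicator A \<omega> * real_cond_exp M G (indicator (E \<inter> Y)) \<omega> \<partial>M)"
        by (rule G.real_cond_exp_intg(2)[OF i0 mG(1), symmetric]) simp
      also have "\<dots> = (\<integral>\<omega>. (indicator A \<omega> * p \<omega>) * real_cond_exp M G (indicator Y) \<omega> \<partial>M)"
      proof (rule integral_cong_AE)
        show "AE \<omega> in M. indicator A \<omega> * real_cond_exp M G (indicator (E \<inter> Y)) \<omega>
            = indicator A \<omega> * p \<omega> * real_cond_exp M G (indicator Y) \<omega>"
          using prodE[OF S] unfolding Y_def by eventually_elim simp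
      qed (simp_all add: p_def)
      also have "\<dots> = (\<integral>\<omega>. (indicator A \<omega> * p \<omega>) * indicator Y \<omega> \<partial>M)"
        by (rule G.real_cond_exp_intg(2)) (use mG i1 in \<open>simp_all add: mult_ac\<close>)
      finally have eq: "(\<integral>\<omega>. indicator A \<omega> * indicator (E \<inter> Y) \<omega> \<partial>M)
          = (\<integral>\<omega>. indicator A \<omega> * (indicator Y \<omega> * p \<omega>) \<partial>M)" by (simp add: mult_ac)
      have "(LINT \<omega>:C|M. h \<omega>) = (\<integral>\<omega>. indicator A \<omega> * indicator (E \<inter> Y) \<omega>
          - indicator A \<omega> * (indicator Y \<omega> * p \<omega>) \<partial>M)"
        unfolding set_lebesgue_integral_def real_scaleR_def iA h_def
        by (intro Bochner_Integration.integral_cong) (auto simp: algebra_simps indicator_def)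
      also have "\<dots> = 0"
        unfolding Bochner_Integration.integral_diff[OF i0 i1] eq by simp
      finally show "(LINT \<omega>:C|M. h \<omega>) = 0" .
    qed
    then have h0: "(LINT \<omega>:C|M. h \<omega>) = 0" if "C \<in> sets Gi" for C using gen(4) that by blast
    have "AE \<omega> in M. real_cond_exp M Gi (indicator E) \<omega> = p \<omega>"
    proof (rule Gi.real_cond_exp_charact)
      fix C assume "C \<in> sets Gi"
      then have CM: "C \<in> sets M" using subi by (auto simp: subalgebra_def)
      have "(LINT \<omega>:C|M. indicator E \<omega> - p \<omega>) = (LINT \<omega>:C|M. indicator E \<omega>) - (LINT \<omega>:C|M. p \<omega>)"
        using CM ip
        unfolding set_lebesgue_integral_def scaleR_diff_right
        by (intro Bochner_Integration.integral_diff integrable_mult_indicator iI E ip)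
      then show "(LINT \<omega>:C|M. indicator E \<omega>) = (LINT \<omega>:C|M. p \<omega>)"
        using h0[OF \<open>C \<in> sets Gi\<close>] by (simp add: h_def)
    qed (simp_all add: iI ip GGi pG)
    then show ?thesis by (simp add: p_def)
  qed
  define \<E> where "\<E> = {A \<inter> (\<Inter>j\<in>J. X j -` T j) |A T. A \<in> sets G \<and> T \<in> Pi J (\<lambda>j. sets (N j))}"
  have gen: "Int_stable \<E>" "\<E> \<subseteq> sets M" "space M \<in> \<E>" "sets GJ \<subseteq> sigma_sets (space M) \<E>"
    unfolding \<E>_def GJ_def using J X by (intro adjoin_generator sub; auto)+
  have "(LINT \<omega>:C|M. f \<omega>) = 0" if C: "C \<in> sigma_sets (space M) \<E>" for C
  proof (rule set_integral_eq_0_generator[OF f(1) gen(1-3) _ C])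
    fix C assume C\<E>: "C \<in> \<E>"
    then obtain A T where C: "C = A \<inter> (\<Inter>j\<in>J. X j -` T j)" and A: "A \<in> sets G"
      and T: "T \<in> Pi J (\<lambda>j. sets (N j))" unfolding \<E>_def by auto
    define E where "E = (\<Inter>j\<in>J. X j -` T j) \<inter> space M"
    define p where "p = real_cond_exp M G (indicator E)"
    have pM[measurable]: "p \<in> borel_measurable M" by (simp add: p_def)
    have AM[measurable]: "A \<in> sets M" using A by (rule inP)
    have CM[measurable]: "C \<in> sets M" using C\<E> gen(2) by auto
    have E[measurable]: "E \<in> sets M"
    proof -
      have "E = space M \<inter> (\<Inter>j\<in>J. X j -` T j)" by (auto simp: E_def)
      moreover have "space M \<in> sets G" using sub sets.top[of G] unfolding subalgebra_def by metis
      ultimately have "E \<in> \<E>" using T unfolding \<E>_def by blast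
      then show ?thesis using gen(2) by blast
    qed
    have iC: "indicator C \<omega> = indicator A \<omega> * (indicator E \<omega> :: real)" for \<omega>
      using sets.sets_into_space[OF AM] by (auto simp: C E_def indicator_def)
    have mGi: "(\<lambda>\<omega>. indicator A \<omega> * f \<omega>) \<in> borel_measurable Gi"
      using f(2) inGi[OF A] by (intro borel_measurable_times) (auto simp: Gi_def)
    have i1: "integrable M (\<lambda>\<omega>. (indicator A \<omega> * f \<omega>) * indicator E \<omega>)"
      using integrable_mult_indicator[OF CM f(1)] by (simp add: iC mult_ac)
    note i2 = Gi.real_cond_exp_intg[OF i1 mGi]
    have ae: "AE \<omega> in M. (indicator A \<omega> * f \<omega>) * real_cond_exp M Gi (indicator E) \<omega>
        = (indicator A \<omega> * p \<omega>) * f \<omega>"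
      using ce[OF T E_def] by eventually_elim (simp add: p_def)
    have i3: "integrable M (\<lambda>\<omega>. (indicator A \<omega> * p \<omega>) * f \<omega>)"
      by (rule integrable_cong_AE_imp[OF i2(1) _ ae]) measurable
    have mG: "(\<lambda>\<omega>. indicator A \<omega> * p \<omega>) \<in> borel_measurable G"
      using A by (intro borel_measurable_times) (simp_all add: p_def)
    have "(LINT \<omega>:C|M. f \<omega>) = (\<integral>\<omega>. (indicator A \<omega> * f \<omega>) * indicator E \<omega> \<partial>M)"
      unfolding set_lebesgue_integral_def real_scaleR_def iC by (simp add: mult_ac)
    also have "\<dots> = (\<integral>\<omega>. (indicator A \<omega> * f \<omega>) * real_cond_exp M Gi (indicator E) \<omega> \<partial>M)"
      using i2(2) by simp
    also have "\<dots> = (\<integral>\<omega>. (indicator A \<omega> * p \<omega>) * f \<omega> \<partial>M)"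
      by (rule integral_cong_AE[OF _ _ ae]) measurable
    also have "\<dots> = (\<integral>\<omega>. (indicator A \<omega> * p \<omega>) * real_cond_exp M G f \<omega> \<partial>M)"
      by (rule G.real_cond_exp_intg(2)[OF i3 mG, symmetric]) simp
    also have "\<dots> = (\<integral>\<omega>. 0 \<partial>M)"
    proof (rule integral_cong_AE)
      show "AE \<omega> in M. indicator A \<omega> * p \<omega> * real_cond_exp M G f \<omega> = 0"
        using zero by eventually_elim simp
    qed measurable
    finally show "(LINT \<omega>:C|M. f \<omega>) = 0" by simp
  qed
  then have "(LINT \<omega>:C|M. f \<omega>) = 0" if "C \<in> sets GJ" for C
    using gen(4) that by blast
  then have z: "AE \<omega> in M. real_cond_exp M GJ f \<omega> = 0"
    by (intro GJ.real_cond_exp_charact f(1)) (simp_all add: set_lebesgue_integral_def)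
  have WJ: "W \<in> borel_measurable GJ" using W(1) by (simp add: GJ_def J_def)
  have [measurable]: "W \<in> borel_measurable M" by (rule measurable_from_subalg[OF subJ WJ])
  have "(\<integral>\<omega>. W \<omega> * f \<omega> \<partial>M) = (\<integral>\<omega>. W \<omega> * real_cond_exp M GJ f \<omega> \<partial>M)"
    by (rule GJ.real_cond_exp_intg(2)[OF W(2) WJ, symmetric]) simp
  also have "\<dots> = (\<integral>\<omega>. 0 \<partial>M)"
  proof (rule integral_cong_AE)
    show "AE \<omega> in M. W \<omega> * real_cond_exp M GJ f \<omega> = 0"
      using z by eventually_elim simp
  qed measurable
  finally show ?thesis by simp
qed

section \<open>The finite-sum problem\<close>

text \<open>The objective \<open>F\<close> is the average of the node objectives \<open>Fi i\<close>, and \<open>U\<close> is the ball that contains all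
  iterates.\<close>

locale finite_sum_problem =
  fixes n :: nat and m :: "nat \<Rightarrow> nat" and \<phi> :: "nat \<Rightarrow> nat \<Rightarrow> 'v::euclidean_space \<Rightarrow> real"
    and L R :: real and xs :: 'v
  assumes n_ge_1: "n \<ge> 1" and m_ge_1: "\<And>i. i < n \<Longrightarrow> m i \<ge> 1"
    and L_pos: "L > 0" and R_pos: "R > 0"
    and convex: "\<And>i j. i < n \<Longrightarrow> j < m i \<Longrightarrow> convex_on UNIV (\<phi> i j)"
    and smooth: "\<And>i j. i < n \<Longrightarrow> j < m i \<Longrightarrow> L_smooth L (\<phi> i j)"
    and minimizer: "is_arg_min (global_obj n m \<phi>) (\<lambda>_. True) xs"
begin

abbreviation "Fi \<equiv> node_obj m \<phi>"
abbreviation "F \<equiv> global_obj n m \<phi>"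
abbreviation "U \<equiv> cball xs R"

lemma L_smooth_node:
  assumes "i < n"
  shows "L_smooth L (Fi i)"
proof -
  have *: "Fi i = (\<lambda>x. (1 / real (card {..<m i})) * (\<Sum>j\<in>{..<m i}. \<phi> i j x))"
    by (auto simp: node_obj_def)
  show ?thesis
    unfolding * using assms m_ge_1[OF assms]
    by (intro L_smooth_average(2) smooth) (auto simp: lessThan_empty_iff)
qed

lemma L_smooth_global: "L_smooth L F"
  and grad_global: "grad F z = (1 / real n) *\<^sub>R (\<Sum>i<n. grad (Fi i) z)"
proof -
  have *: "F = (\<lambda>x. (1 / real (card {..<n})) * (\<Sum>i\<in>{..<n}. Fi i x))"
    by (auto simp: global_obj_def)
  have ne: "finite {..<n}" "{..<n} \<noteq> {}" using n_ge_1 by (auto simp: lessThan_empty_iff)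
  show "L_smooth L F"
    unfolding * by (intro L_smooth_average(2) L_smooth_node ne) auto
  show "grad F z = (1 / real n) *\<^sub>R (\<Sum>i<n. grad (Fi i) z)"
    unfolding * by (subst L_smooth_average(1)[OF L_smooth_node ne]) auto
qed

lemma convex_global: "convex_on UNIV F"
proof -
  have "convex_on UNIV (Fi i)" if "i < n" for i
    unfolding node_obj_def[abs_def] using that by (intro convex_on_average convex) auto
  then show ?thesis
    unfolding global_obj_def[abs_def] by (intro convex_on_average) auto
qed

lemma F_min: "F xs \<le> F z"
  using minimizer by (auto simp: is_arg_min_def not_less)

lemma lipschitz_grad:
  assumes "L_smooth L f"
  shows "norm (grad f z - grad f w) \<le> L * norm (z - w)"
  using assms by (auto simp: L_smooth_def dist_norm dest: lipschitz_onD)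

lemma grad_borel:
  assumes "L_smooth L f"
  shows "grad f \<in> borel_measurable borel"
  using assms by (auto simp: L_smooth_def
      intro!: borel_measurable_continuous_onI lipschitz_on_continuous_on)

lemma F_borel [measurable]: "F \<in> borel_measurable borel"
proof (rule borel_measurable_continuous_onI)
  show "continuous_on UNIV F"
    using L_smooth_global unfolding L_smooth_def gderiv_def
    by (intro continuous_at_imp_continuous_on) (auto intro: has_derivative_continuous)
qed

lemma norm_grad_global_le: "(norm (grad F z))\<^sup>2 \<le> 2 * L * (F z - F xs)"
  by (rule norm_grad_le_gap[OF L_smooth_global L_pos F_min])

lemma gap_le_smooth:
  assumes "z \<in> U"
  shows "F z - F xs \<le> L * R\<^sup>2 / 2"
proof -
  have "F z - F xs \<le> L / 2 * (norm (z - xs))\<^sup>2"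
    using L_smooth_descent[OF L_smooth_global, of z xs]
      grad_minimizer_eq_0[OF L_smooth_global L_pos F_min] by simp
  also have "\<dots> \<le> L / 2 * R\<^sup>2"
    using assms L_pos by (intro mult_left_mono power_mono) (auto simp: dist_norm norm_minus_commute)
  finally show ?thesis by simp
qed

lemma gap_le_grad:
  assumes "z \<in> U"
  shows "(F z - F xs)\<^sup>2 \<le> R\<^sup>2 * (norm (grad F z))\<^sup>2"
proof -
  have "F z - F xs \<le> inner (grad F z) (z - xs)"
    using convex_gradient_inequality[OF convex_global, of z xs] L_smooth_global
    by (simp add: L_smooth_def inner_diff_right)
  also have "\<dots> \<le> norm (grad F z) * norm (z - xs)" by (rule norm_cauchy_schwarz)
  also have "\<dots> \<le> norm (grad F z) * R"
    using assms by (intro mult_left_mono) (auto simp: dist_norm norm_minus_commute)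
  finally have "(F z - F xs)\<^sup>2 \<le> (norm (grad F z) * R)\<^sup>2"
    using F_min[of z] by (intro power_mono) auto
  then show ?thesis by (simp add: power_mult_distrib mult.commute)
qed

text \<open>A gradient step with bias \<open>r\<close> and noise \<open>\<xi>\<close>. The inner product vanishes in
  expectation, provided that \<open>\<xi>\<close> has mean zero given the past.\<close>

lemma biased_gradient_step:
  assumes "0 \<le> h" "h * L \<le> 1" and z: "z \<in> U"
  shows "F (z - h *\<^sub>R (grad F z + r + \<xi>)) - F xs
    \<le> (F z - F xs) - h / (2 * R\<^sup>2) * (F z - F xs)\<^sup>2 + h / 2 * (norm r)\<^sup>2 + L * h\<^sup>2 / 2 * (norm \<xi>)\<^sup>2
      + inner ((L * h\<^sup>2) *\<^sub>R (grad F z + r) - h *\<^sub>R grad F z) \<xi>"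
proof -
  define G where "G = grad F z"
  have "F (z - h *\<^sub>R (G + r + \<xi>)) \<le> F z - h * inner G (G + r + \<xi>)
      + L / 2 * (h\<^sup>2 * (norm (G + r + \<xi>))\<^sup>2)"
    using L_smooth_descent[OF L_smooth_global, of "z - h *\<^sub>R (G + r + \<xi>)" z]
    by (simp add: G_def power_mult_distrib)
  also have "\<dots> = F z - h * inner G (G + r) + h / 2 * ((h * L) * (norm (G + r))\<^sup>2)
      + L * h\<^sup>2 / 2 * (norm \<xi>)\<^sup>2 + inner ((L * h\<^sup>2) *\<^sub>R (G + r) - h *\<^sub>R G) \<xi>"
    unfolding power2_norm_eq_inner
    by (simp add: inner_simps inner_commute algebra_simps power2_eq_square)
  finally have 1: "F (z - h *\<^sub>R (G + r + \<xi>)) \<le> \<dots>" .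
  have 2: "h / 2 * ((h * L) * (norm (G + r))\<^sup>2) \<le> h / 2 * (1 * (norm (G + r))\<^sup>2)"
    using assms by (intro mult_left_mono mult_right_mono) auto
  have 3: "- (h * inner G (G + r)) + h / 2 * (1 * (norm (G + r))\<^sup>2)
      = - (h / 2 * (norm G)\<^sup>2) + h / 2 * (norm r)\<^sup>2"
    unfolding power2_norm_eq_inner by (simp add: inner_simps inner_commute algebra_simps)
  from 1 2 3 have "F (z - h *\<^sub>R (G + r + \<xi>)) - F xs \<le> F z - F xs - h / 2 * (norm G)\<^sup>2
      + h / 2 * (norm r)\<^sup>2 + L * h\<^sup>2 / 2 * (norm \<xi>)\<^sup>2 + inner ((L * h\<^sup>2) *\<^sub>R (G + r) - h *\<^sub>R G) \<xi>"
    by linarith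
  moreover have "h / (2 * R\<^sup>2) * (F z - F xs)\<^sup>2 \<le> h / (2 * R\<^sup>2) * (R\<^sup>2 * (norm G)\<^sup>2)"
    unfolding G_def using assms by (intro mult_left_mono gap_le_grad z) auto
  moreover have "h / (2 * R\<^sup>2) * (R\<^sup>2 * (norm G)\<^sup>2) = h / 2 * (norm G)\<^sup>2"
    using R_pos by (simp add: field_simps)
  ultimately show ?thesis by (simp add: G_def)
qed

text \<open>The bias of averaging gradients taken at scattered points. The Hessian of \<open>F\<close> at the mean point
  may be subtracted, because the deviations from the mean sum to zero; what remains is
  governed by the heterogeneity and the variation of the node Hessians.\<close>

lemma averaging_bias:
  fixes p :: "nat \<Rightarrow> 'v" and w :: 'v
  assumes C2: "\<And>i. i < n \<Longrightarrow> C2_on U (Fi i)" and M: "M \<ge> 0" and h: "h \<ge> 0"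
    and het: "\<And>i z. i < n \<Longrightarrow> z \<in> U \<Longrightarrow> norm (hess U (Fi i) z - hess U F z) \<le> h"
    and lip: "\<And>i z w. i < n \<Longrightarrow> z \<in> U \<Longrightarrow> w \<in> U \<Longrightarrow>
      norm (hess U (Fi i) z - hess U (Fi i) w) \<le> M * norm (z - w)"
    and p: "\<And>i. i < n \<Longrightarrow> p i \<in> U"
  defines "a \<equiv> (1 / real n) *\<^sub>R (\<Sum>i<n. p i)"
  shows "(norm ((1 / real n) *\<^sub>R (\<Sum>i<n. grad (Fi i) (p i)) - grad F a))\<^sup>2
    \<le> 4 * (h + M * R)\<^sup>2 * ((1 / real n) * (\<Sum>i<n. (norm (p i - w))\<^sup>2))"
proof -
  define Q where "Q = hess U F a"
  \<comment> \<open>two points of the ball are at distance at most \<open>2 * R\<close>\<close>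
  define k where "k = 2 * (h + M * R)"
  have aU: "a \<in> U" unfolding a_def using p n_ge_1 by (intro convex_average_mem) auto
  have k: "norm (hess U (Fi i) z - Q) \<le> k" if i: "i < n" and z: "z \<in> U" for i z
  proof -
    have "norm (z - a) \<le> 2 * R"
      using z aU dist_triangle2[of z a xs] by (simp add: dist_norm norm_minus_commute)
    then have "M * norm (z - a) \<le> M * (2 * R)" using M by (intro mult_left_mono)
    moreover have "norm (hess U (Fi i) z - Q)
        \<le> norm (hess U (Fi i) z - hess U (Fi i) a) + norm (hess U (Fi i) a - Q)"
      using norm_triangle_ineq[of "hess U (Fi i) z - hess U (Fi i) a" "hess U (Fi i) a - Q"] by simp
    ultimately show ?thesis
      using lip[OF i z aU] het[OF i aU] h by (simp add: k_def Q_def)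
  qed
  define d where "d i = grad (Fi i) (p i) - grad (Fi i) a - blinfun_apply Q (p i - a)" for i
  have d: "norm (d i) \<le> k * norm (p i - a)" if "i < n" for i
    unfolding d_def
    by (rule gradient_linearization_bound[OF C2[OF that] convex_cball p[OF that] aU k[OF that]])
  have "(\<Sum>i<n. p i - a) = 0"
    using n_ge_1 by (simp add: a_def sum_subtractf sum_constant_scaleR)
  then have "(\<Sum>i<n. blinfun_apply Q (p i - a)) = 0"
    by (simp flip: blinfun.sum_right)
  then have "(\<Sum>i<n. d i) = (\<Sum>i<n. grad (Fi i) (p i)) - (\<Sum>i<n. grad (Fi i) a)"
    by (simp add: d_def sum_subtractf)
  then have "(norm ((1 / real n) *\<^sub>R (\<Sum>i<n. grad (Fi i) (p i)) - grad F a))\<^sup>2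
      = (norm ((1 / real n) *\<^sub>R (\<Sum>i<n. d i)))\<^sup>2"
    by (simp add: grad_global scaleR_diff_right)
  also have "\<dots> \<le> (1 / real n) * (\<Sum>i<n. (norm (d i))\<^sup>2)" by (rule norm_average_power2_le)
  also have "\<dots> \<le> (1 / real n) * (\<Sum>i<n. k\<^sup>2 * (norm (p i - a))\<^sup>2)"
    using d by (intro mult_left_mono sum_mono) (auto simp flip: power_mult_distrib intro!: power_mono)
  also have "\<dots> = k\<^sup>2 * ((1 / real n) * (\<Sum>i<n. (norm (p i - a))\<^sup>2))"
    by (simp add: sum_distrib_left mult_ac)
  also have "\<dots> \<le> k\<^sup>2 * ((1 / real n) * (\<Sum>i<n. (norm (p i - w))\<^sup>2))"
    unfolding a_def using n_ge_1 by (intro mult_left_mono sum_dist_average_le) auto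
  also have "k\<^sup>2 = 4 * (h + M * R)\<^sup>2" unfolding k_def power_mult_distrib by simp
  finally show ?thesis .
qed

end

section \<open>Local steps with control variates\<close>

text \<open>The algorithm together with the standing assumptions, on \<open>real ^ 'd\<close> because conditional expectations
  are taken coordinatewise. No second-order information is needed here.\<close>

locale controlled_local_sgd = finite_sum_problem n m \<phi> L R xs + prob_space P
  for P :: "'w measure" and n m and \<phi> :: "nat \<Rightarrow> nat \<Rightarrow> real ^ 'd \<Rightarrow> real" and L R xs +
  fixes H b :: nat and \<theta> :: real
    and B :: "nat \<Rightarrow> nat \<Rightarrow> nat \<Rightarrow> 'w \<Rightarrow> nat set"
    and x :: "nat \<Rightarrow> 'w \<Rightarrow> real ^ 'd"
    and y :: "nat \<Rightarrow> nat \<Rightarrow> nat \<Rightarrow> 'w \<Rightarrow> real ^ 'd"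
    and c :: "nat \<Rightarrow> nat \<Rightarrow> 'w \<Rightarrow> real ^ 'd"
    and cbar :: "nat \<Rightarrow> 'w \<Rightarrow> real ^ 'd"
  assumes H_ge_1: "H \<ge> 1" and b_ge_1: "b \<ge> 1"
    and \<theta>: "0 < \<theta>" "\<theta> \<le> 1" "288 * \<theta>\<^sup>2 < 1"
    and init_x: "x 0 \<in> borel_measurable P"
    and init_c: "\<And>i. i < n \<Longrightarrow> c i 0 \<in> borel_measurable P"
    and init_c_sq: "\<And>i. i < n \<Longrightarrow> integrable P (\<lambda>\<omega>. (norm (c i 0 \<omega>))\<^sup>2)"
    and batch: "\<And>i t l. i < n \<Longrightarrow> l < H \<Longrightarrow>
          B i t l \<in> measurable P (count_space {S. S \<subseteq> {..<m i} \<and> card S = b})"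
    and alg_c0: "\<And>\<omega>. \<omega> \<in> space P \<Longrightarrow> cbar 0 \<omega> = (1 / real n) *\<^sub>R (\<Sum>i<n. c i 0 \<omega>)"
    and alg_y0: "\<And>i t \<omega>. i < n \<Longrightarrow> \<omega> \<in> space P \<Longrightarrow> y i t 0 \<omega> = x t \<omega>"
    and alg_y: "\<And>i t l \<omega>. i < n \<Longrightarrow> l < H \<Longrightarrow> \<omega> \<in> space P \<Longrightarrow>
          y i t (Suc l) \<omega> = y i t l \<omega> - (\<theta> / (L * real H)) *\<^sub>R
            ((1 / real b) *\<^sub>R (\<Sum>j\<in>B i t l \<omega>. grad (\<phi> i j) (y i t l \<omega>)) - c i t \<omega> + cbar t \<omega>)"
    and alg_c: "\<And>i t \<omega>. i < n \<Longrightarrow> \<omega> \<in> space P \<Longrightarrow>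
          c i (Suc t) \<omega> = c i t \<omega> - cbar t \<omega>
            + (1 / (real H * (\<theta> / (L * real H)))) *\<^sub>R (x t \<omega> - y i t H \<omega>)"
    and alg_x: "\<And>t \<omega>. \<omega> \<in> space P \<Longrightarrow>
          x (Suc t) \<omega> = x t \<omega> + (1 / real n) *\<^sub>R (\<Sum>i<n. y i t H \<omega> - x t \<omega>)"
    and alg_cbar: "\<And>t \<omega>. \<omega> \<in> space P \<Longrightarrow>
          cbar (Suc t) \<omega> = cbar t \<omega> + (1 / real n) *\<^sub>R (\<Sum>i<n. c i (Suc t) \<omega> - c i t \<omega>)"
    and confined: "AE \<omega> in P. \<forall>t. x t \<omega> \<in> cball xs R \<and> (\<forall>i<n. \<forall>l\<le>H. y i t l \<omega> \<in> cball xs R)"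
    and indep: "\<And>i t l. i < n \<Longrightarrow> l < H \<Longrightarrow>
          cond_indep_vars P (local_alg P n H (x 0) (\<lambda>i. c i 0) B i t l)
            (\<lambda>(k, r). count_space {S. S \<subseteq> {..<m k} \<and> card S = b})
            (\<lambda>(k, r). B k t r) ({..<n} \<times> {..<H})"
    and unbiased: "\<And>i t l. i < n \<Longrightarrow> l < H \<Longrightarrow>
          AE \<omega> in P. vec_cond_exp P (local_alg P n H (x 0) (\<lambda>i. c i 0) B i t l)
              (\<lambda>\<omega>. (1 / real b) *\<^sub>R (\<Sum>j\<in>B i t l \<omega>. grad (\<phi> i j) (y i t l \<omega>))) \<omega>
            = grad (node_obj m \<phi> i) (y i t l \<omega>)"
    and variance: "\<And>i t l. i < n \<Longrightarrow> l < H \<Longrightarrow>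
          AE \<omega> in P. real_cond_exp P (local_alg P n H (x 0) (\<lambda>i. c i 0) B i t l)
              (\<lambda>\<omega>. (norm ((1 / real b) *\<^sub>R (\<Sum>j\<in>B i t l \<omega>. grad (\<phi> i j) (y i t l \<omega>))
                - grad (node_obj m \<phi> i) (y i t l \<omega>)))\<^sup>2) \<omega>
            \<le> node_var m \<phi> xs R i / real b"
begin

abbreviation "\<eta> \<equiv> \<theta> / (L * real H)"

text \<open>The minibatch gradient of node \<open>i\<close> in local step \<open>l\<close> of round \<open>t\<close>, and its deviation from the gradient
  of the node objective.\<close>

definition "sg i t l \<omega> = (1 / real b) *\<^sub>R (\<Sum>j\<in>B i t l \<omega>. grad (\<phi> i j) (y i t l \<omega>))"

definition "noise i t l \<omega> = sg i t l \<omega> - grad (Fi i) (y i t l \<omega>)"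

text \<open>\<open>past t\<close> and \<open>local i t l\<close> are the sigma-algebras generated before round \<open>t\<close> and, for node \<open>i\<close>, before
  local step \<open>l\<close> of that round. \<open>X t\<close> is the family of the minibatches of round \<open>t\<close>, indexed by the pairs
  (node, local step) in \<open>steps\<close>, and \<open>N\<close> the family of their value spaces.\<close>

abbreviation "past t \<equiv> round_alg P n H (x 0) (\<lambda>i. c i 0) B t"
abbreviation "local i t l \<equiv> local_alg P n H (x 0) (\<lambda>i. c i 0) B i t l"
abbreviation "N \<equiv> \<lambda>(k, r :: nat). count_space {S. S \<subseteq> {..<m k} \<and> card S = b}"
abbreviation "X t \<equiv> \<lambda>(k, r). B k t r"
abbreviation "steps \<equiv> {..<n} \<times> {..<H}"

text \<open>Everything known before round \<open>t\<close>, together with the minibatches of round \<open>t\<close> with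
  (node, local step) in \<open>J\<close>.\<close>

definition "known t J = adjoin P (past t) N (X t) J"

text \<open>All iterates stay in the ball.\<close>

abbreviation "good \<omega> \<equiv> \<omega> \<in> space P \<and> (\<forall>t. x t \<omega> \<in> U \<and> (\<forall>i<n. \<forall>l\<le>H. y i t l \<omega> \<in> U))"

lemma AE_good: "AE \<omega> in P. good \<omega>"
  using confined by (auto intro: AE_I2)

subsection \<open>Measurability\<close>

lemma X_measurable: "j \<in> steps \<Longrightarrow> X t j \<in> measurable P (N j)"
  using batch by auto

lemma B_measurable:
  assumes "i < n" "l < H" "X t (i, l) \<in> measurable Q (N (i, l))"
  shows "B i t l \<in> measurable Q (count_space UNIV)"
  using measurable_compose[OF assms(3), of "\<lambda>S. S" "count_space UNIV"] by simp

lemma space_past [simp]: "space (past t) = space P"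
  by (simp add: round_alg_def space_measure_of_conv)

lemma sets_past: "sets (past t) = sigma_sets (space P)
     (sets (vimage_algebra (space P) (x 0) borel)
      \<union> (\<Union>i<n. sets (vimage_algebra (space P) (c i 0) borel))
      \<union> (\<Union>s<t. \<Union>i<n. \<Union>l<H. sets (vimage_algebra (space P) (B i s l) (count_space UNIV))))"
proof -
  have v: "A \<subseteq> space P" if "A \<in> sets (vimage_algebra (space P) f K)" for A and f :: "'w \<Rightarrow> 'e" and K
    using sets.sets_into_space[OF that] by simp
  show ?thesis
    unfolding round_alg_def by (rule sets_measure_of) (auto dest!: v)
qed

lemma sub_past: "subalgebra P (past t)"
proof -
  have "B i s l \<in> measurable P (count_space UNIV)" if "i < n" "l < H" for i s l
    using that X_measurable by (intro B_measurable) auto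
  then have "sets (past t) \<subseteq> sets P"
    unfolding sets_past
    by (intro sets.sigma_sets_subset Un_least UN_least)
      (auto dest!: subsetD[OF sets_image_in_sets[OF refl], rotated] intro: init_x init_c)
  then show ?thesis by (simp add: subalgebra_def)
qed

lemma sub_past_Suc: "subalgebra (past (Suc t)) (past t)"
proof -
  have "sets (past t) \<subseteq> sets (past (Suc t))"
    unfolding sets_past by (rule sigma_sets_mono') (auto simp: less_Suc_eq)
  then show ?thesis by (simp add: subalgebra_def)
qed

lemma sub_known: "J \<subseteq> steps \<Longrightarrow> subalgebra P (known t J)"
  unfolding known_def using X_measurable by (intro subalgebra_adjoin sub_past) blast

lemma sub_known_past: "subalgebra (known t J) (past t)"
  unfolding known_def by (rule subalgebra_adjoin_base[OF sub_past])

lemma space_known [simp]: "space (known t J) = space P"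
  by (simp add: known_def)

lemma B_known:
  assumes "(i, l) \<in> J" "J \<subseteq> steps"
  shows "B i t l \<in> measurable (known t J) (count_space UNIV)"
  using assms X_measurable unfolding known_def
  by (intro B_measurable measurable_adjoin_var[OF sub_past]) auto

lemma sub_known_round: "subalgebra (past (Suc t)) (known t steps)"
  unfolding known_def
proof (rule sets_adjoin_least[OF sub_past])
  show "sets (past t) \<subseteq> sets (past (Suc t))" using sub_past_Suc by (simp add: subalgebra_def)
  fix j assume "j \<in> steps"
  then obtain i l where j: "j = (i, l)" "i < n" "l < H" by auto
  show "X t j \<in> measurable (past (Suc t)) (N j)"
    unfolding j split
  proof (rule measurableI)
    show "B i t l \<omega> \<in> space (count_space {S. S \<subseteq> {..<m i} \<and> card S = b})" if "\<omega> \<in> space (past (Suc t))" for \<omega>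
      using measurable_space[OF batch[OF j(2,3)]] that by simp
    fix A :: "nat set set"
    have "B i t l -` A \<inter> space P \<in> sets (vimage_algebra (space P) (B i t l) (count_space UNIV))"
      by (rule in_vimage_algebra) simp
    then show "B i t l -` A \<inter> space (past (Suc t)) \<in> sets (past (Suc t))"
      unfolding sets_past space_past using j(2,3) by (intro sigma_sets.Basic) blast
  qed
qed simp

text \<open>The sigma-algebra generated by a minibatch does not depend on whether its values are taken in all
  sets of indices or only in those of size \<open>b\<close>.\<close>

lemma local_eq_known:
  assumes "i < n" "l \<le> H"
  shows "local i t l = known t ({i} \<times> {..<l})"
proof -
  have "sets (vimage_algebra (space P) (B i t r) (count_space UNIV))
      = sets (vimage_algebra (space P) (B i t r) (N (i, r)))" if "r < l" for r
  proof (rule antisym)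
    have r: "r < H" using that assms by auto
    let ?V = "vimage_algebra (space P) (B i t r) (N (i, r))"
    have X: "B i t r \<in> measurable ?V (N (i, r))"
      using measurable_space[OF batch[OF assms(1) r]] by (intro measurable_vimage_algebra1) auto
    show "sets (vimage_algebra (space P) (B i t r) (count_space UNIV)) \<subseteq> sets ?V"
      using assms r X by (intro sets_image_in_sets B_measurable) auto
    show "sets ?V \<subseteq> sets (vimage_algebra (space P) (B i t r) (count_space UNIV))"
      using measurable_space[OF batch[OF assms(1) r], of _ t]
      by (intro sets_image_in_sets measurableI) (auto intro: in_vimage_algebra)
  qed
  then have "(\<Union>r<l. sets (vimage_algebra (space P) (B i t r) (count_space UNIV)))
      = (\<Union>j\<in>{i} \<times> {..<l}. sets (vimage_algebra (space P) (X t j) (N j)))"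
    by auto
  then show ?thesis
    unfolding local_alg_def known_def adjoin_def by simp
qed

lemma sg_measurable:
  assumes i: "i < n" "l < H" and Q: "space Q = space P" "y i t l \<in> borel_measurable Q"
    "B i t l \<in> measurable Q (count_space UNIV)"
  shows "sg i t l \<in> borel_measurable Q"
proof -
  have "(\<lambda>\<omega>. (1 / real b) *\<^sub>R (\<Sum>j<m i. if j \<in> B i t l \<omega> then grad (\<phi> i j) (y i t l \<omega>) else 0))
      \<in> borel_measurable Q"
  proof (intro borel_measurable_scaleR borel_measurable_const borel_measurable_sum measurable_If)
    fix j assume "j \<in> {..<m i}"
    then show "(\<lambda>\<omega>. grad (\<phi> i j) (y i t l \<omega>)) \<in> borel_measurable Q"
      using smooth i by (intro measurable_compose[OF Q(2)] grad_borel) auto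
    have "(\<lambda>\<omega>. j \<in> B i t l \<omega>) \<in> measurable Q (count_space UNIV)"
      by (rule measurable_compose[OF Q(3)]) simp
    then show "{\<omega> \<in> space Q. j \<in> B i t l \<omega>} \<in> sets Q"
      unfolding pred_def .
  qed
  also have "?this \<longleftrightarrow> ?thesis"
  proof (rule measurable_cong)
    fix \<omega> assume "\<omega> \<in> space Q"
    then have "B i t l \<omega> \<subseteq> {..<m i}"
      using measurable_space[OF batch[OF i, of t]] Q(1) by auto
    then show "(1 / real b) *\<^sub>R (\<Sum>j<m i. if j \<in> B i t l \<omega> then grad (\<phi> i j) (y i t l \<omega>) else 0)
      = sg i t l \<omega>"
      unfolding sg_def by (simp add: sum.inter_restrict[symmetric] Int_absorb1)
  qed
  finally show ?thesis .
qed

lemma alg_y_sg: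
  assumes "i < n" "l < H" "\<omega> \<in> space P"
  shows "y i t (Suc l) \<omega> = y i t l \<omega> - \<eta> *\<^sub>R (sg i t l \<omega> - c i t \<omega> + cbar t \<omega>)"
  unfolding sg_def by (rule alg_y[OF assms])

lemma y_known_aux:
  assumes xc: "x t \<in> borel_measurable (past t)" "\<And>i. i < n \<Longrightarrow> c i t \<in> borel_measurable (past t)"
    "cbar t \<in> borel_measurable (past t)" and i: "i < n" and J: "J \<subseteq> steps"
  shows "l \<le> H \<Longrightarrow> {i} \<times> {..<l} \<subseteq> J \<Longrightarrow> y i t l \<in> borel_measurable (known t J)"
proof (induction l)
  case 0
  have "x t \<in> borel_measurable (known t J)" by (rule measurable_from_subalg[OF sub_known_past xc(1)])
  then show ?case using alg_y0[OF i] by (subst measurable_cong[where g = "x t"]) auto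
next
  case (Suc l)
  have l: "l < H" "(i, l) \<in> J" using Suc.prems by auto
  have "{i} \<times> {..<l} \<subseteq> J" using Suc.prems by auto
  then have [measurable]: "y i t l \<in> borel_measurable (known t J)" using Suc by simp
  have [measurable]: "c i t \<in> borel_measurable (known t J)" "cbar t \<in> borel_measurable (known t J)"
    using xc i by (auto intro: measurable_from_subalg[OF sub_known_past])
  have [measurable]: "sg i t l \<in> borel_measurable (known t J)"
    using i l J by (intro sg_measurable B_known) auto
  have "(\<lambda>\<omega>. y i t l \<omega> - \<eta> *\<^sub>R (sg i t l \<omega> - c i t \<omega> + cbar t \<omega>)) \<in> borel_measurable (known t J)"
    by measurable
  then show ?case
    by (subst measurable_cong[OF alg_y_sg[OF i l(1)]]) auto
qed

lemma state_past:
  "x t \<in> borel_measurable (past t) \<and> (\<forall>i<n. c i t \<in> borel_measurable (past t))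
    \<and> cbar t \<in> borel_measurable (past t)"
proof (induction t)
  case 0
  have v: "f \<in> borel_measurable (past 0)"
    if "sets (vimage_algebra (space P) f borel) \<subseteq> sets (past 0)" for f :: "'w \<Rightarrow> real ^ 'd"
    using that by (intro measurableI) (auto dest: in_vimage_algebra[of _ borel f "space P"])
  have x0: "x 0 \<in> borel_measurable (past 0)"
    unfolding sets_past by (intro v) (auto simp: sets_past intro: sigma_sets.Basic)
  have c0: "c i 0 \<in> borel_measurable (past 0)" if "i < n" for i
    using that by (intro v) (auto simp: sets_past intro: sigma_sets.Basic)
  have "(\<lambda>\<omega>. (1 / real n) *\<^sub>R (\<Sum>i<n. c i 0 \<omega>)) \<in> borel_measurable (past 0)"
    using c0 by (intro borel_measurable_scaleR borel_measurable_sum) auto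
  then have "cbar 0 \<in> borel_measurable (past 0)"
    using alg_c0 by (subst measurable_cong[where g = "\<lambda>\<omega>. (1 / real n) *\<^sub>R (\<Sum>i<n. c i 0 \<omega>)"]) auto
  with x0 c0 show ?case by auto
next
  case (Suc t)
  have up: "f \<in> borel_measurable (past (Suc t))" if "f \<in> borel_measurable (past t)" for f :: "'w \<Rightarrow> real ^ 'd"
    using sub_past_Suc that by (rule measurable_from_subalg)
  have x[measurable]: "x t \<in> borel_measurable (past (Suc t))" and cb[measurable]: "cbar t \<in> borel_measurable (past (Suc t))"
    and c: "\<And>i. i < n \<Longrightarrow> c i t \<in> borel_measurable (past (Suc t))" using Suc by (auto intro: up)
  have y: "y i t H \<in> borel_measurable (past (Suc t))" if "i < n" for i
    using Suc that by (intro measurable_from_subalg[OF sub_known_round] y_known_aux) auto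
  have c': "c i (Suc t) \<in> borel_measurable (past (Suc t))" if "i < n" for i
  proof -
    have [measurable]: "y i t H \<in> borel_measurable (past (Suc t))"
      "c i t \<in> borel_measurable (past (Suc t))" using that y c by auto
    have "(\<lambda>\<omega>. c i t \<omega> - cbar t \<omega> + (1 / (real H * \<eta>)) *\<^sub>R (x t \<omega> - y i t H \<omega>)) \<in> borel_measurable (past (Suc t))"
      by measurable
    then show ?thesis by (subst measurable_cong[OF alg_c[OF that]]) auto
  qed
  have "(\<lambda>\<omega>. x t \<omega> + (1 / real n) *\<^sub>R (\<Sum>i<n. y i t H \<omega> - x t \<omega>)) \<in> borel_measurable (past (Suc t))"
    using y by (intro borel_measurable_add borel_measurable_scaleR borel_measurable_sum
      borel_measurable_diff) auto
  then have x': "x (Suc t) \<in> borel_measurable (past (Suc t))"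
    by (subst measurable_cong[OF alg_x]) auto
  have "(\<lambda>\<omega>. cbar t \<omega> + (1 / real n) *\<^sub>R (\<Sum>i<n. c i (Suc t) \<omega> - c i t \<omega>)) \<in> borel_measurable (past (Suc t))"
    using c c' by (intro borel_measurable_add borel_measurable_scaleR borel_measurable_sum
      borel_measurable_diff) auto
  then have "cbar (Suc t) \<in> borel_measurable (past (Suc t))"
    by (subst measurable_cong[OF alg_cbar]) auto
  with x' c' show ?case by auto
qed

lemma x_known: "x t \<in> borel_measurable (known t J)"
  using state_past by (intro measurable_from_subalg[OF sub_known_past]) auto

lemma y_known:
  assumes "i < n" "l \<le> H" "{i} \<times> {..<l} \<subseteq> J" "J \<subseteq> steps"
  shows "y i t l \<in> borel_measurable (known t J)"
  using state_past assms by (intro y_known_aux) auto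

lemma grad_y_known:
  assumes "i < n" "l \<le> H" "{i} \<times> {..<l} \<subseteq> J" "J \<subseteq> steps"
  shows "(\<lambda>\<omega>. grad (Fi i) (y i t l \<omega>)) \<in> borel_measurable (known t J)"
  using assms by (intro measurable_compose[OF y_known] grad_borel L_smooth_node)

lemma noise_known:
  assumes "i < n" "l < H" "{i} \<times> {..<Suc l} \<subseteq> J" "J \<subseteq> steps"
  shows "noise i t l \<in> borel_measurable (known t J)"
  unfolding noise_def[abs_def] using assms
  by (intro borel_measurable_diff sg_measurable grad_y_known y_known B_known) auto

lemma measurable_known_P:
  assumes "f \<in> borel_measurable (known t J)" "J \<subseteq> steps"
  shows "f \<in> borel_measurable P"
  using assms by (intro measurable_from_subalg[OF sub_known])

subsection \<open>Bounded random variables\<close>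

text \<open>Random variables that are bounded as long as all iterates stay in the ball, hence almost surely.
  The class is closed under the algebraic operations and its real-valued members are
  integrable. It does not contain \<open>c i 0\<close>, which is only assumed to be square integrable.\<close>

definition ess_bounded :: "('w \<Rightarrow> 'e::{real_normed_vector, second_countable_topology}) \<Rightarrow> bool" where
  "ess_bounded f \<longleftrightarrow> f \<in> borel_measurable P \<and> (\<exists>k. \<forall>\<omega>. good \<omega> \<longrightarrow> norm (f \<omega>) \<le> k)"

lemma ess_boundedI:
  "f \<in> borel_measurable P \<Longrightarrow> (\<And>\<omega>. good \<omega> \<Longrightarrow> norm (f \<omega>) \<le> k) \<Longrightarrow> ess_bounded f"
  unfolding ess_bounded_def by blast

lemma ess_bounded_measurable: "ess_bounded f \<Longrightarrow> f \<in> borel_measurable P"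
  by (simp add: ess_bounded_def)

lemma ess_bounded_bound:
  assumes "ess_bounded f"
  shows "\<exists>k\<ge>0. \<forall>\<omega>. good \<omega> \<longrightarrow> norm (f \<omega>) \<le> k"
proof -
  obtain k where "\<forall>\<omega>. good \<omega> \<longrightarrow> norm (f \<omega>) \<le> k"
    using assms unfolding ess_bounded_def by blast
  then show ?thesis by (intro exI[of _ "\<bar>k\<bar>"]) (auto intro: order_trans[OF _ abs_ge_self])
qed

lemma ess_bounded_integrable:
  fixes f :: "'w \<Rightarrow> real"
  assumes "ess_bounded f"
  shows "integrable P f"
proof -
  obtain k where k: "\<forall>\<omega>. good \<omega> \<longrightarrow> norm (f \<omega>) \<le> k"
    using ess_bounded_bound[OF assms] by blast
  have "AE \<omega> in P. norm (f \<omega>) \<le> k" using AE_good by eventually_elim (use k in blast)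
  then show ?thesis
    using ess_bounded_measurable[OF assms] by (rule integrable_const_bound)
qed

lemma ess_bounded_const: "ess_bounded (\<lambda>_. k)"
  by (rule ess_boundedI[where k = "norm k"]) auto

lemma ess_bounded_add:
  assumes "ess_bounded f" "ess_bounded h"
  shows "ess_bounded (\<lambda>\<omega>. f \<omega> + h \<omega>)"
proof -
  obtain j where j: "j \<ge> 0" "\<forall>\<omega>. good \<omega> \<longrightarrow> norm (f \<omega>) \<le> j"
    using ess_bounded_bound[OF assms(1)] by blast
  obtain k where k: "k \<ge> 0" "\<forall>\<omega>. good \<omega> \<longrightarrow> norm (h \<omega>) \<le> k"
    using ess_bounded_bound[OF assms(2)] by blast
  note [measurable] = assms[THEN ess_bounded_measurable]
  show ?thesis
  proof (rule ess_boundedI[where k = "j + k"])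
    show "norm (f \<omega> + h \<omega>) \<le> j + k" if "good \<omega>" for \<omega>
      by (intro norm_triangle_le add_mono j(2)[rule_format] k(2)[rule_format] that)
  qed measurable
qed

lemma ess_bounded_scaleR:
  assumes "ess_bounded f"
  shows "ess_bounded (\<lambda>\<omega>. r *\<^sub>R f \<omega>)"
proof -
  obtain k where k: "\<forall>\<omega>. good \<omega> \<longrightarrow> norm (f \<omega>) \<le> k"
    using ess_bounded_bound[OF assms] by blast
  note [measurable] = ess_bounded_measurable[OF assms]
  show ?thesis
  proof (rule ess_boundedI[where k = "\<bar>r\<bar> * k"])
    show "norm (r *\<^sub>R f \<omega>) \<le> \<bar>r\<bar> * k" if "good \<omega>" for \<omega>
      unfolding norm_scaleR by (intro mult_left_mono k[rule_format] that abs_ge_zero)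
  qed measurable
qed

lemma ess_bounded_diff:
  assumes "ess_bounded f" "ess_bounded h"
  shows "ess_bounded (\<lambda>\<omega>. f \<omega> - h \<omega>)"
  using ess_bounded_add[OF assms(1) ess_bounded_scaleR[OF assms(2), of "-1"]] by simp

lemma ess_bounded_sum:
  assumes "\<And>i. i \<in> I \<Longrightarrow> ess_bounded (f i)"
  shows "ess_bounded (\<lambda>\<omega>. \<Sum>i\<in>I. f i \<omega>)"
  using assms
  by (induction I rule: infinite_finite_induct) (auto intro: ess_bounded_add ess_bounded_const)

lemma ess_bounded_inner:
  fixes f h :: "'w \<Rightarrow> 'e::{real_inner, second_countable_topology}"
  assumes "ess_bounded f" "ess_bounded h"
  shows "ess_bounded (\<lambda>\<omega>. inner (f \<omega>) (h \<omega>))"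
proof -
  obtain j where j: "j \<ge> 0" "\<forall>\<omega>. good \<omega> \<longrightarrow> norm (f \<omega>) \<le> j"
    using ess_bounded_bound[OF assms(1)] by blast
  obtain k where k: "k \<ge> 0" "\<forall>\<omega>. good \<omega> \<longrightarrow> norm (h \<omega>) \<le> k"
    using ess_bounded_bound[OF assms(2)] by blast
  show ?thesis
  proof (rule ess_boundedI[where k = "j * k"])
    show "(\<lambda>\<omega>. inner (f \<omega>) (h \<omega>)) \<in> borel_measurable P"
      using assms[THEN ess_bounded_measurable] by measurable
    fix \<omega> assume g: "good \<omega>"
    have "\<bar>inner (f \<omega>) (h \<omega>)\<bar> \<le> norm (f \<omega>) * norm (h \<omega>)" by (rule Cauchy_Schwarz_ineq2)
    also have "\<dots> \<le> j * k" by (intro mult_mono j k j(2)[rule_format] k(2)[rule_format] g norm_ge_zero)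
    finally show "norm (inner (f \<omega>) (h \<omega>)) \<le> j * k" by simp
  qed
qed

lemma ess_bounded_norm_sq:
  fixes f :: "'w \<Rightarrow> 'e::{real_inner, second_countable_topology}"
  shows "ess_bounded f \<Longrightarrow> ess_bounded (\<lambda>\<omega>. (norm (f \<omega>))\<^sup>2)"
  unfolding power2_norm_eq_inner by (rule ess_bounded_inner)

lemma ess_bounded_grad:
  assumes "L_smooth L f" "Y \<in> borel_measurable P" "\<And>\<omega>. good \<omega> \<Longrightarrow> Y \<omega> \<in> U"
  shows "ess_bounded (\<lambda>\<omega>. grad f (Y \<omega>))"
proof (rule ess_boundedI)
  show "(\<lambda>\<omega>. grad f (Y \<omega>)) \<in> borel_measurable P"
    by (rule measurable_compose[OF assms(2) grad_borel[OF assms(1)]])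
  fix \<omega> assume "good \<omega>"
  then have "norm (Y \<omega> - xs) \<le> R" using assms(3) by (auto simp: dist_norm norm_minus_commute)
  then have "L * norm (Y \<omega> - xs) \<le> L * R" using L_pos by (intro mult_left_mono) auto
  then show "norm (grad f (Y \<omega>)) \<le> norm (grad f xs) + L * R"
    using lipschitz_grad[OF assms(1), of "Y \<omega>" xs] norm_triangle_sub[of "grad f (Y \<omega>)" "grad f xs"]
    by linarith
qed

lemma ess_bounded_gap:
  assumes "Y \<in> borel_measurable P" "\<And>\<omega>. good \<omega> \<Longrightarrow> Y \<omega> \<in> U"
  shows "ess_bounded (\<lambda>\<omega>. F (Y \<omega>) - F xs)"
proof (rule ess_boundedI)
  show "(\<lambda>\<omega>. F (Y \<omega>) - F xs) \<in> borel_measurable P" using assms(1) by measurable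
  fix \<omega> assume "good \<omega>"
  then show "norm (F (Y \<omega>) - F xs) \<le> L * R\<^sup>2 / 2"
    using gap_le_smooth[OF assms(2)] F_min[of "Y \<omega>"] by auto
qed

lemma ess_bounded_point:
  assumes "Y \<in> borel_measurable P" "\<And>\<omega>. good \<omega> \<Longrightarrow> Y \<omega> \<in> U"
  shows "ess_bounded Y"
proof (rule ess_boundedI[OF assms(1)])
  fix \<omega> assume "good \<omega>"
  then show "norm (Y \<omega>) \<le> norm xs + R"
    using assms(2) norm_triangle_sub[of "Y \<omega>" xs] by (fastforce simp: dist_norm norm_minus_commute)
qed

lemma x_measurable: "x t \<in> borel_measurable P"
  by (rule measurable_known_P[OF x_known[of t "{}"]]) auto

lemma y_measurable: "i < n \<Longrightarrow> l \<le> H \<Longrightarrow> y i t l \<in> borel_measurable P"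
  by (rule measurable_known_P[OF y_known[of i l steps]]) auto

lemma c_measurable: "i < n \<Longrightarrow> c i t \<in> borel_measurable P"
  using state_past by (intro measurable_from_subalg[OF sub_past]) auto

lemma cbar_measurable: "cbar t \<in> borel_measurable P"
  using state_past by (intro measurable_from_subalg[OF sub_past]) auto

lemma ess_bounded_x: "ess_bounded (x t)"
  by (rule ess_bounded_point[OF x_measurable]) auto

lemma ess_bounded_y: "i < n \<Longrightarrow> l \<le> H \<Longrightarrow> ess_bounded (y i t l)"
  by (rule ess_bounded_point[OF y_measurable]) auto

lemma ess_bounded_grad_x: "L_smooth L f \<Longrightarrow> ess_bounded (\<lambda>\<omega>. grad f (x t \<omega>))"
  by (rule ess_bounded_grad[OF _ x_measurable]) auto

lemma ess_bounded_grad_y: "L_smooth L f \<Longrightarrow> i < n \<Longrightarrow> l \<le> H \<Longrightarrow> ess_bounded (\<lambda>\<omega>. grad f (y i t l \<omega>))"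
  by (rule ess_bounded_grad[OF _ y_measurable]) auto

lemma ess_bounded_sg:
  assumes i: "i < n" "l < H"
  shows "ess_bounded (sg i t l)"
proof (rule ess_boundedI)
  show "sg i t l \<in> borel_measurable P"
    using i by (intro sg_measurable y_measurable B_measurable X_measurable) auto
  fix \<omega> assume g: "good \<omega>"
  have B: "B i t l \<omega> \<subseteq> {..<m i}"
    using measurable_space[OF batch[OF i, of t]] g by auto
  have *: "norm (grad (\<phi> i j) (y i t l \<omega>)) \<le> norm (grad (\<phi> i j) xs) + L * R" if "j < m i" for j
  proof -
    have "norm (y i t l \<omega> - xs) \<le> R" using g i by (auto simp: dist_norm norm_minus_commute)
    then have "L * norm (y i t l \<omega> - xs) \<le> L * R" using L_pos by (intro mult_left_mono) auto
    then show ?thesis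
      using lipschitz_grad[OF smooth[OF i(1) that], of "y i t l \<omega>" xs]
        norm_triangle_sub[of "grad (\<phi> i j) (y i t l \<omega>)" "grad (\<phi> i j) xs"] by linarith
  qed
  have "norm (sg i t l \<omega>) \<le> (1 / real b) * (\<Sum>j\<in>B i t l \<omega>. norm (grad (\<phi> i j) (y i t l \<omega>)))"
    unfolding sg_def norm_scaleR by (simp add: divide_right_mono norm_sum)
  also have "\<dots> \<le> (1 / real b) * (\<Sum>j\<in>B i t l \<omega>. norm (grad (\<phi> i j) xs) + L * R)"
    using B by (intro mult_left_mono sum_mono *) auto
  also have "\<dots> \<le> (1 / real b) * (\<Sum>j<m i. norm (grad (\<phi> i j) xs) + L * R)"
    using B L_pos R_pos by (intro mult_left_mono sum_mono2) auto
  finally show "norm (sg i t l \<omega>) \<le> (1 / real b) * (\<Sum>j<m i. norm (grad (\<phi> i j) xs) + L * R)" .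
qed

lemma ess_bounded_noise: "i < n \<Longrightarrow> l < H \<Longrightarrow> ess_bounded (noise i t l)"
  unfolding noise_def[abs_def]
  by (intro ess_bounded_diff ess_bounded_sg ess_bounded_grad_y L_smooth_node) auto

lemmas ess_bounded_intros = ess_bounded_const ess_bounded_add ess_bounded_diff ess_bounded_scaleR
  ess_bounded_sum ess_bounded_inner ess_bounded_norm_sq ess_bounded_x ess_bounded_y ess_bounded_grad_x
  ess_bounded_grad_y ess_bounded_sg ess_bounded_noise L_smooth_node L_smooth_global

subsection \<open>The minibatch noise\<close>

text \<open>By cancelling conditional means, the noise is orthogonal to the past; by conditional
  independence, the past may be enlarged by all other minibatches of the same round.\<close>

lemma noise_orthogonal:
  assumes i: "i < n" "l < H"
    and W: "W \<in> borel_measurable (known t (steps - {(i, l)}))" "ess_bounded W"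
  shows "(\<integral>\<omega>. inner (W \<omega>) (noise i t l \<omega>) \<partial>P) = 0"
proof -
  let ?G = "local i t l"
  have G: "?G = known t ({i} \<times> {..<l})" using i by (intro local_eq_known) auto
  have sub: "subalgebra P ?G" unfolding G using i by (intro sub_known) auto
  interpret G: finite_measure_subalgebra P ?G by standard (rule sub)
  have spG: "space ?G = space P" using sub by (simp add: subalgebra_def)
  have yG: "y i t l \<in> borel_measurable ?G"
    unfolding G using i by (intro y_known) auto
  have nA: "noise i t l \<in> borel_measurable (adjoin P ?G N (X t) {(i, l)})"
  proof -
    have y: "y i t l \<in> borel_measurable (adjoin P ?G N (X t) {(i, l)})"
      by (rule measurable_adjoin_base[OF sub yG])
    have "X t (i, l) \<in> measurable (adjoin P ?G N (X t) {(i, l)}) (N (i, l))"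
      using i X_measurable by (intro measurable_adjoin_var sub) auto
    with y show ?thesis
      unfolding noise_def[abs_def] using i
      by (intro borel_measurable_diff sg_measurable B_measurable measurable_compose[OF y] grad_borel
          L_smooth_node) auto
  qed
  have WA: "W \<in> borel_measurable (adjoin P ?G N (X t) (steps - {(i, l)}))"
  proof (rule measurable_from_subalg[OF _ W(1)])
    have "sets (past t) \<subseteq> sets ?G" unfolding G using sub_known_past by (simp add: subalgebra_def)
    moreover have "sets ?G \<subseteq> sets (adjoin P ?G N (X t) (steps - {(i, l)}))"
      using subalgebra_adjoin_base[OF sub] unfolding subalgebra_def by blast
    ultimately have past: "sets (past t) \<subseteq> sets (adjoin P ?G N (X t) (steps - {(i, l)}))"
      by blast
    show "subalgebra (adjoin P ?G N (X t) (steps - {(i, l)})) (known t (steps - {(i, l)}))"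
      unfolding known_def
    proof (rule sets_adjoin_least[OF sub_past _ past])
      show "X t j \<in> measurable (adjoin P ?G N (X t) (steps - {(i, l)})) (N j)"
        if "j \<in> steps - {(i, l)}" for j
        using that by (intro measurable_adjoin_var[OF sub] X_measurable) auto
    qed simp
  qed
  have zero: "(\<integral>\<omega>. W \<omega> $ k * noise i t l \<omega> $ k \<partial>P) = 0" for k
  proof (rule cond_indep_vars_orthogonal[OF sub indep[OF i]])
    have cmp: "ess_bounded (\<lambda>\<omega>. f \<omega> $ k)" if "ess_bounded f" for f :: "'w \<Rightarrow> real ^ 'd"
      unfolding cart_eq_inner_axis using that by (intro ess_bounded_intros)
    show "finite steps" "(i, l) \<in> steps" using i by auto
    show "integrable P (\<lambda>\<omega>. noise i t l \<omega> $ k)"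
      using i by (intro ess_bounded_integrable cmp ess_bounded_noise)
    show "(\<lambda>\<omega>. noise i t l \<omega> $ k) \<in> borel_measurable (adjoin P ?G N (X t) {(i, l)})"
      unfolding cart_eq_inner_axis using nA by measurable
    show "(\<lambda>\<omega>. W \<omega> $ k) \<in> borel_measurable (adjoin P ?G N (X t) (steps - {(i, l)}))"
      unfolding cart_eq_inner_axis using WA by measurable
    have "ess_bounded (\<lambda>\<omega>. inner (W \<omega> $ k) (noise i t l \<omega> $ k))"
      using i W by (intro ess_bounded_inner cmp ess_bounded_noise)
    then show "integrable P (\<lambda>\<omega>. W \<omega> $ k * noise i t l \<omega> $ k)"
      by (intro ess_bounded_integrable) simp
    have "AE \<omega> in P. real_cond_exp P ?G (\<lambda>\<omega>. sg i t l \<omega> $ k) \<omega> = grad (Fi i) (y i t l \<omega>) $ k"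
      using unbiased[OF i] by eventually_elim (auto simp: vec_cond_exp_def sg_def vec_eq_iff)
    moreover have "AE \<omega> in P. real_cond_exp P ?G (\<lambda>\<omega>. grad (Fi i) (y i t l \<omega>) $ k) \<omega>
        = grad (Fi i) (y i t l \<omega>) $ k"
    proof (rule G.real_cond_exp_F_meas)
      show "integrable P (\<lambda>\<omega>. grad (Fi i) (y i t l \<omega>) $ k)"
        using i by (intro ess_bounded_integrable cmp ess_bounded_grad_y L_smooth_node) auto
      have "(\<lambda>\<omega>. grad (Fi i) (y i t l \<omega>)) \<in> borel_measurable ?G"
        using i by (intro measurable_compose[OF yG] grad_borel L_smooth_node)
      then show "(\<lambda>\<omega>. grad (Fi i) (y i t l \<omega>) $ k) \<in> borel_measurable ?G"
        unfolding cart_eq_inner_axis by measurable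
    qed
    moreover have "AE \<omega> in P. real_cond_exp P ?G (\<lambda>\<omega>. sg i t l \<omega> $ k - grad (Fi i) (y i t l \<omega>) $ k) \<omega>
        = real_cond_exp P ?G (\<lambda>\<omega>. sg i t l \<omega> $ k) \<omega>
          - real_cond_exp P ?G (\<lambda>\<omega>. grad (Fi i) (y i t l \<omega>) $ k) \<omega>"
      using i by (intro G.real_cond_exp_diff ess_bounded_integrable cmp ess_bounded_sg
          ess_bounded_grad_y L_smooth_node) auto
    ultimately show "AE \<omega> in P. real_cond_exp P ?G (\<lambda>\<omega>. noise i t l \<omega> $ k) \<omega> = 0"
      unfolding noise_def vector_minus_component by eventually_elim simp
  qed
  have int: "integrable P (\<lambda>\<omega>. W \<omega> $ k * noise i t l \<omega> $ k)" for k
  proof -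
    have "ess_bounded (\<lambda>\<omega>. inner (inner (W \<omega>) (axis k 1)) (inner (noise i t l \<omega>) (axis k 1)))"
      using i W by (intro ess_bounded_intros)
    then show ?thesis
      by (intro ess_bounded_integrable) (simp add: cart_eq_inner_axis)
  qed
  have "(\<integral>\<omega>. inner (W \<omega>) (noise i t l \<omega>) \<partial>P) = (\<Sum>k\<in>UNIV. \<integral>\<omega>. W \<omega> $ k * noise i t l \<omega> $ k \<partial>P)"
    unfolding inner_vec_def inner_real_def using int
    by (rule Bochner_Integration.integral_sum)
  then show ?thesis by (simp add: zero)
qed

lemma noise_uncorrelated:
  assumes "i < n" "l < H" "k < n" "r < H" "(i, l) \<noteq> (k, r)"
  shows "(\<integral>\<omega>. inner (noise i t l \<omega>) (noise k t r \<omega>) \<partial>P) = 0"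
proof (cases "i = k \<and> r < l")
  case True
  then have "(\<integral>\<omega>. inner (noise k t r \<omega>) (noise i t l \<omega>) \<partial>P) = 0"
    using assms by (intro noise_orthogonal noise_known ess_bounded_noise) auto
  then show ?thesis by (simp add: inner_commute)
next
  case False
  then show ?thesis
    using assms by (intro noise_orthogonal noise_known ess_bounded_noise) auto
qed

text \<open>The squared noise level, the maximum of the node variances.\<close>

definition "vsq = (MAX i\<in>{..<n}. node_var m \<phi> xs R i)"

lemma noise_variance:
  assumes i: "i < n" "l < H"
  shows "(\<integral>\<omega>. (norm (noise i t l \<omega>))\<^sup>2 \<partial>P) \<le> vsq / real b"
proof -
  let ?G = "local i t l"
  have sub: "subalgebra P ?G"
    using i unfolding local_eq_known[OF i(1) less_imp_le[OF i(2)]] by (intro sub_known) auto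
  interpret G: finite_measure_subalgebra P ?G by standard (rule sub)
  have int: "integrable P (\<lambda>\<omega>. (norm (noise i t l \<omega>))\<^sup>2)"
    using i by (intro ess_bounded_integrable ess_bounded_intros)
  have "(\<integral>\<omega>. (norm (noise i t l \<omega>))\<^sup>2 \<partial>P)
      = (\<integral>\<omega>. real_cond_exp P ?G (\<lambda>\<omega>. (norm (noise i t l \<omega>))\<^sup>2) \<omega> \<partial>P)"
    by (rule G.real_cond_exp_int(2)[OF int, symmetric])
  also have "\<dots> \<le> (\<integral>\<omega>. node_var m \<phi> xs R i / real b \<partial>P)"
    using variance[OF i] unfolding noise_def sg_def
    by (intro integral_mono_AE) (use G.real_cond_exp_int(1)[OF int] in \<open>auto simp: noise_def sg_def\<close>)
  also have "\<dots> \<le> vsq / real b"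
    using i prob_space by (auto simp: vsq_def intro!: divide_right_mono Max_ge)
  finally show ?thesis .
qed

lemma vsq_nonneg: "vsq \<ge> 0"
proof -
  have "0 \<le> (\<integral>\<omega>. (norm (noise 0 0 0 \<omega>))\<^sup>2 \<partial>P)" by simp
  also have "\<dots> \<le> vsq / real b" using n_ge_1 H_ge_1 by (intro noise_variance) auto
  finally show ?thesis using b_ge_1 by (simp add: zero_le_divide_iff)
qed

lemma noise_sum_variance:
  assumes "finite I" "inj_on p I" "p ` I \<subseteq> steps"
  shows "(\<integral>\<omega>. (norm (\<Sum>k\<in>I. noise (fst (p k)) t (snd (p k)) \<omega>))\<^sup>2 \<partial>P) \<le> real (card I) * (vsq / real b)"
proof -
  have s: "fst (p k) < n" "snd (p k) < H" if "k \<in> I" for k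
    using assms(3) that by (auto simp: image_subset_iff mem_Times_iff)
  have "(\<integral>\<omega>. (norm (\<Sum>k\<in>I. noise (fst (p k)) t (snd (p k)) \<omega>))\<^sup>2 \<partial>P)
      = (\<Sum>k\<in>I. \<integral>\<omega>. (norm (noise (fst (p k)) t (snd (p k)) \<omega>))\<^sup>2 \<partial>P)"
  proof (rule integral_norm_sum_orthogonal[OF assms(1)])
    fix k r assume kr: "k \<in> I" "r \<in> I"
    show "integrable P (\<lambda>\<omega>. inner (noise (fst (p k)) t (snd (p k)) \<omega>) (noise (fst (p r)) t (snd (p r)) \<omega>))"
      using s kr by (intro ess_bounded_integrable ess_bounded_intros)
    assume "k \<noteq> r"
    then have "p k \<noteq> p r" using assms(2) kr by (auto dest: inj_onD)
    then show "(\<integral>\<omega>. inner (noise (fst (p k)) t (snd (p k)) \<omega>) (noise (fst (p r)) t (snd (p r)) \<omega>) \<partial>P) = 0"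
      using s kr by (intro noise_uncorrelated) (auto simp: prod_eq_iff)
  qed
  also have "\<dots> \<le> real (card I) * (vsq / real b)"
    using s by (intro sum_bounded_above noise_variance)
  finally show ?thesis .
qed

lemma noise_sum_variance_local:
  assumes "i < n" "l \<le> H"
  shows "(\<integral>\<omega>. (norm (\<Sum>r<l. noise i t r \<omega>))\<^sup>2 \<partial>P) \<le> real l * (vsq / real b)"
proof -
  have "(\<lambda>r. (i, r)) ` {..<l} \<subseteq> steps" using assms by auto
  then show ?thesis
    using noise_sum_variance[of "{..<l}" "\<lambda>r. (i, r)" t] by (simp add: inj_on_def)
qed

lemma noise_sum_variance_nodes:
  assumes "l < H"
  shows "(\<integral>\<omega>. (norm (\<Sum>i<n. noise i t l \<omega>))\<^sup>2 \<partial>P) \<le> real n * (vsq / real b)"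
proof -
  have "(\<lambda>i. (i, l)) ` {..<n} \<subseteq> steps" using assms by auto
  then show ?thesis
    using noise_sum_variance[of "{..<n}" "\<lambda>i. (i, l)" t] by (simp add: inj_on_def)
qed

subsection \<open>The iterates in closed form\<close>

lemma \<eta>_pos: "\<eta> > 0"
  using \<theta> L_pos H_ge_1 by simp

lemma cbar_average:
  assumes "\<omega> \<in> space P"
  shows "cbar t \<omega> = (1 / real n) *\<^sub>R (\<Sum>i<n. c i t \<omega>)"
  by (induction t) (simp_all add: alg_c0 alg_cbar assms sum_subtractf scaleR_diff_right)

lemma y_eq:
  assumes "i < n" "\<omega> \<in> space P"
  shows "l \<le> H \<Longrightarrow> y i t l \<omega> = x t \<omega> - \<eta> *\<^sub>R ((\<Sum>r<l. sg i t r \<omega>) - real l *\<^sub>R (c i t \<omega> - cbar t \<omega>))"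
proof (induction l)
  case 0
  then show ?case by (simp add: alg_y0 assms)
next
  case (Suc l)
  then have "y i t (Suc l) \<omega> = x t \<omega> - \<eta> *\<^sub>R ((\<Sum>r<l. sg i t r \<omega>) - real l *\<^sub>R (c i t \<omega> - cbar t \<omega>))
      - \<eta> *\<^sub>R (sg i t l \<omega> - c i t \<omega> + cbar t \<omega>)"
    using alg_y_sg[of i l \<omega> t] assms by simp
  then show ?case by (simp add: algebra_simps)
qed

lemma c_Suc_eq:
  assumes "i < n" "\<omega> \<in> space P"
  shows "c i (Suc t) \<omega> = (1 / real H) *\<^sub>R (\<Sum>r<H. sg i t r \<omega>)"
proof -
  define e where "e = \<eta>"
  have e: "e > 0" using \<eta>_pos by (simp add: e_def)
  have H: "real H > 0" using H_ge_1 by simp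
  have "c i (Suc t) \<omega> = c i t \<omega> - cbar t \<omega>
      + (1 / (real H * e)) *\<^sub>R (e *\<^sub>R ((\<Sum>r<H. sg i t r \<omega>) - real H *\<^sub>R (c i t \<omega> - cbar t \<omega>)))"
    using alg_c[OF assms, of t] y_eq[OF assms, of H t] by (simp add: e_def)
  also have "\<dots> = (1 / real H) *\<^sub>R (\<Sum>r<H. sg i t r \<omega>)"
    using e H by (simp add: scaleR_diff_right)
  finally show ?thesis .
qed

text \<open>The average over the nodes of the iterates after \<open>l\<close> local steps.\<close>

definition "ybar t l \<omega> = (1 / real n) *\<^sub>R (\<Sum>i<n. y i t l \<omega>)"

lemma ybar_0: "\<omega> \<in> space P \<Longrightarrow> ybar t 0 \<omega> = x t \<omega>"
  using n_ge_1 by (simp add: ybar_def alg_y0 sum_constant_scaleR del: sum_constant)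

lemma ybar_H: "\<omega> \<in> space P \<Longrightarrow> ybar t H \<omega> = x (Suc t) \<omega>"
  using n_ge_1 by (simp add: ybar_def alg_x sum_subtractf sum_constant_scaleR scaleR_diff_right del: sum_constant)

text \<open>The control variates cancel in the average over the nodes.\<close>

lemma ybar_Suc:
  assumes "l < H" "\<omega> \<in> space P"
  shows "ybar t (Suc l) \<omega> = ybar t l \<omega> - \<eta> *\<^sub>R ((1 / real n) *\<^sub>R (\<Sum>i<n. sg i t l \<omega>))"
proof -
  have "(\<Sum>i<n. y i t (Suc l) \<omega>)
      = (\<Sum>i<n. y i t l \<omega>) - \<eta> *\<^sub>R ((\<Sum>i<n. sg i t l \<omega>) - (\<Sum>i<n. c i t \<omega>) + real n *\<^sub>R cbar t \<omega>)"
    using assms by (simp add: alg_y_sg sum_subtractf sum.distrib sum_constant_scaleR del: sum_constant flip: scaleR_sum_right)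
  also have "real n *\<^sub>R cbar t \<omega> = (\<Sum>i<n. c i t \<omega>)"
    using cbar_average[OF assms(2)] n_ge_1 by simp
  finally show ?thesis
    unfolding ybar_def by (simp add: scaleR_diff_right)
qed

lemma ybar_in_ball: "good \<omega> \<Longrightarrow> l \<le> H \<Longrightarrow> ybar t l \<omega> \<in> U"
  unfolding ybar_def using n_ge_1 by (intro convex_average_mem) auto

lemma ess_bounded_ybar: "l \<le> H \<Longrightarrow> ess_bounded (ybar t l)"
  unfolding ybar_def[abs_def] by (intro ess_bounded_intros) auto

lemma ybar_known: "l \<le> H \<Longrightarrow> {..<n} \<times> {..<l} \<subseteq> J \<Longrightarrow> J \<subseteq> steps \<Longrightarrow> ybar t l \<in> borel_measurable (known t J)"
  unfolding ybar_def[abs_def]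
  by (intro borel_measurable_scaleR borel_measurable_const borel_measurable_sum y_known) auto

subsection \<open>Optimality gap and control error\<close>

text \<open>The expected optimality gap of round \<open>t\<close>, the error of a control variate as an estimate of the node
  gradient, and the largest mean squared error among the nodes.\<close>

definition "gap t = (\<integral>\<omega>. F (x t \<omega>) - F xs \<partial>P)"

definition "err i t \<omega> = c i t \<omega> - grad (Fi i) (x t \<omega>)"

definition "q t = (MAX i\<in>{..<n}. \<integral>\<omega>. (norm (err i t \<omega>))\<^sup>2 \<partial>P)"

lemma gap_integrable: "integrable P (\<lambda>\<omega>. F (x t \<omega>) - F xs)"
  by (intro ess_bounded_integrable ess_bounded_gap x_measurable) auto

lemma gap_nonneg: "gap t \<ge> 0"
  unfolding gap_def using F_min by (intro integral_nonneg_AE) auto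

lemma gap_le: "gap t \<le> L * R\<^sup>2 / 2"
proof -
  have "gap t \<le> (\<integral>\<omega>. L * R\<^sup>2 / 2 \<partial>P)"
    unfolding gap_def
  proof (rule integral_mono_AE[OF gap_integrable])
    show "AE \<omega> in P. F (x t \<omega>) - F xs \<le> L * R\<^sup>2 / 2"
      using AE_good by eventually_elim (rule gap_le_smooth, blast)
  qed simp
  then show ?thesis by (simp add: prob_space)
qed

lemma integrable_norm_sq_add:
  fixes f h :: "'w \<Rightarrow> real ^ 'd"
  assumes "f \<in> borel_measurable P" "h \<in> borel_measurable P"
    "integrable P (\<lambda>\<omega>. (norm (f \<omega>))\<^sup>2)" "integrable P (\<lambda>\<omega>. (norm (h \<omega>))\<^sup>2)"
  shows "integrable P (\<lambda>\<omega>. (norm (f \<omega> + h \<omega>))\<^sup>2)"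
proof (rule Bochner_Integration.integrable_bound)
  show "integrable P (\<lambda>\<omega>. 2 * (norm (f \<omega>))\<^sup>2 + 2 * (norm (h \<omega>))\<^sup>2)" using assms by simp
  show "(\<lambda>\<omega>. (norm (f \<omega> + h \<omega>))\<^sup>2) \<in> borel_measurable P" using assms(1,2) by measurable
  show "AE \<omega> in P. norm ((norm (f \<omega> + h \<omega>))\<^sup>2) \<le> norm (2 * (norm (f \<omega>))\<^sup>2 + 2 * (norm (h \<omega>))\<^sup>2)"
    using norm_add_power2_le by (intro AE_I2) (auto intro: order_trans[OF _ abs_ge_self])
qed

lemma err_sq_integrable:
  assumes i: "i < n"
  shows "integrable P (\<lambda>\<omega>. (norm (err i t \<omega>))\<^sup>2)"
proof -
  have c: "integrable P (\<lambda>\<omega>. (norm (c i t \<omega>))\<^sup>2)"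
  proof (cases t)
    case 0
    then show ?thesis using init_c_sq[OF i] by simp
  next
    case (Suc s)
    have "ess_bounded (\<lambda>\<omega>. (1 / real H) *\<^sub>R (\<Sum>r<H. sg i s r \<omega>))"
      using i by (intro ess_bounded_intros) auto
    then have "integrable P (\<lambda>\<omega>. (norm ((1 / real H) *\<^sub>R (\<Sum>r<H. sg i s r \<omega>)))\<^sup>2)"
      by (intro ess_bounded_integrable ess_bounded_norm_sq)
    then show ?thesis
      by (subst Bochner_Integration.integrable_cong[OF refl]) (use Suc i in \<open>simp_all add: c_Suc_eq\<close>)
  qed
  have e: "ess_bounded (\<lambda>\<omega>. - 1 *\<^sub>R grad (Fi i) (x t \<omega>))"
    using i by (intro ess_bounded_intros)
  have "integrable P (\<lambda>\<omega>. (norm (c i t \<omega> + - 1 *\<^sub>R grad (Fi i) (x t \<omega>)))\<^sup>2)"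
    using c_measurable[OF i] ess_bounded_measurable[OF e] c
      ess_bounded_integrable[OF ess_bounded_norm_sq[OF e]] by (rule integrable_norm_sq_add)
  then show ?thesis by (simp add: err_def)
qed

lemma err_le_q: "i < n \<Longrightarrow> (\<integral>\<omega>. (norm (err i t \<omega>))\<^sup>2 \<partial>P) \<le> q t"
  unfolding q_def by (intro Max_ge) auto

lemma q_nonneg: "q t \<ge> 0"
  using err_le_q[of 0 t] n_ge_1 by (intro order_trans[OF _ err_le_q[of 0 t]]) auto

text \<open>The direction of the first local step of node \<open>i\<close> with the full gradient in place of the
  minibatch gradient.\<close>

definition "dir i t \<omega> = grad (Fi i) (x t \<omega>) - c i t \<omega> + cbar t \<omega>"

lemma
  assumes i: "i < n"
  shows dir_sq_integrable: "integrable P (\<lambda>\<omega>. (norm (dir i t \<omega>))\<^sup>2)"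
    and dir_sq_le: "(\<integral>\<omega>. (norm (dir i t \<omega>))\<^sup>2 \<partial>P) \<le> 4 * L * gap t + 8 * q t"
proof -
  define rhs where "rhs \<omega> = 4 * L * (F (x t \<omega>) - F xs) + 4 * (norm (err i t \<omega>))\<^sup>2
      + 4 * ((1 / real n) * (\<Sum>k<n. (norm (err k t \<omega>))\<^sup>2))" for \<omega>
  have pt: "(norm (dir i t \<omega>))\<^sup>2 \<le> rhs \<omega>" if \<omega>: "\<omega> \<in> space P" for \<omega>
  proof -
    have "dir i t \<omega> = grad F (x t \<omega>) + (- err i t \<omega> + (1 / real n) *\<^sub>R (\<Sum>k<n. err k t \<omega>))"
      using cbar_average[OF \<omega>, of t]
      by (simp add: dir_def err_def grad_global sum_subtractf scaleR_diff_right)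
    then have "(norm (dir i t \<omega>))\<^sup>2 \<le> 2 * (norm (grad F (x t \<omega>)))\<^sup>2
        + 2 * (norm (- err i t \<omega> + (1 / real n) *\<^sub>R (\<Sum>k<n. err k t \<omega>)))\<^sup>2"
      by (simp only: norm_add_power2_le)
    moreover have "(norm (- err i t \<omega> + (1 / real n) *\<^sub>R (\<Sum>k<n. err k t \<omega>)))\<^sup>2
        \<le> 2 * (norm (err i t \<omega>))\<^sup>2 + 2 * (norm ((1 / real n) *\<^sub>R (\<Sum>k<n. err k t \<omega>)))\<^sup>2"
      using norm_add_power2_le[of "- err i t \<omega>" "(1 / real n) *\<^sub>R (\<Sum>k<n. err k t \<omega>)"]
      unfolding norm_minus_cancel .
    moreover have "(norm ((1 / real n) *\<^sub>R (\<Sum>k<n. err k t \<omega>)))\<^sup>2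
        \<le> (1 / real n) * (\<Sum>k<n. (norm (err k t \<omega>))\<^sup>2)"
      by (rule norm_average_power2_le)
    moreover have "2 * (norm (grad F (x t \<omega>)))\<^sup>2 \<le> 4 * L * (F (x t \<omega>) - F xs)"
      using norm_grad_global_le[of "x t \<omega>"] by simp
    ultimately show ?thesis unfolding rhs_def by linarith
  qed
  have ek: "integrable P (\<lambda>\<omega>. (1 / real n) * (\<Sum>k<n. (norm (err k t \<omega>))\<^sup>2))"
    by (intro integrable_mult_right Bochner_Integration.integrable_sum err_sq_integrable) simp
  have irhs: "integrable P rhs"
    unfolding rhs_def using i
    by (intro Bochner_Integration.integrable_add integrable_mult_right gap_integrable ek err_sq_integrable)
  have m: "dir i t \<in> borel_measurable P"
    unfolding dir_def[abs_def] using i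
    by (intro borel_measurable_add borel_measurable_diff c_measurable cbar_measurable
        measurable_compose[OF x_measurable] grad_borel L_smooth_node)
  show int: "integrable P (\<lambda>\<omega>. (norm (dir i t \<omega>))\<^sup>2)"
  proof (rule Bochner_Integration.integrable_bound[OF irhs])
    show "(\<lambda>\<omega>. (norm (dir i t \<omega>))\<^sup>2) \<in> borel_measurable P" using m by measurable
    show "AE \<omega> in P. norm ((norm (dir i t \<omega>))\<^sup>2) \<le> norm (rhs \<omega>)"
      using pt by (intro AE_I2) (auto intro: order_trans[OF _ abs_ge_self])
  qed
  have "(\<integral>\<omega>. (norm (dir i t \<omega>))\<^sup>2 \<partial>P) \<le> (\<integral>\<omega>. rhs \<omega> \<partial>P)"
    by (rule integral_mono[OF int irhs pt])
  also have "\<dots> = 4 * L * gap t + 4 * (\<integral>\<omega>. (norm (err i t \<omega>))\<^sup>2 \<partial>P)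
      + 4 * ((1 / real n) * (\<Sum>k<n. \<integral>\<omega>. (norm (err k t \<omega>))\<^sup>2 \<partial>P))"
  proof -
    define w where "w \<omega> = (1 / real n) * (\<Sum>k<n. (norm (err k t \<omega>))\<^sup>2)" for \<omega>
    have "(\<integral>\<omega>. w \<omega> \<partial>P) = (1 / real n) * (\<Sum>k<n. \<integral>\<omega>. (norm (err k t \<omega>))\<^sup>2 \<partial>P)"
      using err_sq_integrable by (simp add: w_def Bochner_Integration.integral_sum)
    moreover have "integrable P w" using ek by (simp add: w_def[abs_def])
    ultimately show ?thesis
      unfolding rhs_def gap_def w_def[symmetric]
      using gap_integrable[of t] err_sq_integrable[OF i, of t] by simp
  qed
  also have "\<dots> \<le> 4 * L * gap t + 4 * q t + 4 * q t"
    using i n_ge_1 L_pos by (intro add_mono mult_left_mono average_const_le err_le_q) auto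
  finally show "(\<integral>\<omega>. (norm (dir i t \<omega>))\<^sup>2 \<partial>P) \<le> 4 * L * gap t + 8 * q t" by simp
qed

subsection \<open>Drift of the local iterates\<close>

text \<open>A bound on the mean squared distance of the local iterates of round \<open>t\<close> from \<open>x t\<close>.\<close>

definition "drift t = 16 / 5 * (\<theta>\<^sup>2 / L\<^sup>2) * (vsq / (real H * real b) + 4 * L * gap t + 8 * q t)"

lemma drift_nonneg: "drift t \<ge> 0"
  using vsq_nonneg gap_nonneg q_nonneg L_pos by (simp add: drift_def)

lemma drift_le:
  "drift t \<le> 96 * \<theta>\<^sup>2 / L * gap t + 32 * \<theta>\<^sup>2 * vsq / (L\<^sup>2 * real H * real b) + 192 * \<theta>\<^sup>2 / L\<^sup>2 * q t"
proof -
  define w where "w = vsq / (real H * real b)"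
  have nn: "w \<ge> 0" "L * gap t \<ge> 0" "q t \<ge> 0"
    using vsq_nonneg gap_nonneg q_nonneg L_pos by (simp_all add: w_def)
  have "drift t = \<theta>\<^sup>2 / L\<^sup>2 * (16 / 5 * w + 64 / 5 * (L * gap t) + 128 / 5 * q t)"
    by (simp add: drift_def w_def algebra_simps)
  also have "\<dots> \<le> \<theta>\<^sup>2 / L\<^sup>2 * (96 * (L * gap t) + 32 * w + 192 * q t)"
    using nn by (intro mult_left_mono) auto
  also have "\<dots> = 96 * \<theta>\<^sup>2 / L * gap t + 32 * \<theta>\<^sup>2 * vsq / (L\<^sup>2 * real H * real b) + 192 * \<theta>\<^sup>2 / L\<^sup>2 * q t"
    using L_pos by (simp add: w_def distrib_left power2_eq_square mult_ac)
  finally show ?thesis .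
qed

text \<open>Unrolling the local steps, the drift is bounded by noise, accumulated earlier drift and \<open>dir\<close>. As
  \<open>3 * \<theta>\<^sup>2 < 1 / 16\<close>, the earlier drift contributes at most the slack between \<open>drift t\<close>
  and \<open>15 / 16 * drift t\<close>, so the bound propagates along the round.\<close>

lemma drift_bound:
  assumes i: "i < n"
  shows "l \<le> H \<Longrightarrow> (\<integral>\<omega>. (norm (y i t l \<omega> - x t \<omega>))\<^sup>2 \<partial>P) \<le> drift t"
proof (induction l rule: less_induct)
  case (less l)
  define u where "u r = (\<integral>\<omega>. (norm (y i t r \<omega> - x t \<omega>))\<^sup>2 \<partial>P)" for r
  define d where "d = 4 * L * gap t + 8 * q t"
  have d0: "d \<ge> 0" using gap_nonneg q_nonneg L_pos by (simp add: d_def)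
  have H: "real H > 0" "real b > 0" "real l \<le> real H" using H_ge_1 b_ge_1 less.prems by auto
  define rhs where "rhs \<omega> = 3 * \<eta>\<^sup>2 * ((norm (\<Sum>r<l. noise i t r \<omega>))\<^sup>2
      + real l * (L\<^sup>2 * (\<Sum>r<l. (norm (y i t r \<omega> - x t \<omega>))\<^sup>2)) + (real l)\<^sup>2 * (norm (dir i t \<omega>))\<^sup>2)" for \<omega>
  have pt: "(norm (y i t l \<omega> - x t \<omega>))\<^sup>2 \<le> rhs \<omega>" if \<omega>: "\<omega> \<in> space P" for \<omega>
  proof -
    define s1 where "s1 = (\<Sum>r<l. noise i t r \<omega>)"
    define s2 where "s2 = (\<Sum>r<l. grad (Fi i) (y i t r \<omega>) - grad (Fi i) (x t \<omega>))"
    define s3 where "s3 = real l *\<^sub>R dir i t \<omega>"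
    have "y i t l \<omega> - x t \<omega> = - (\<eta> *\<^sub>R (s1 + s2 + s3))"
      unfolding y_eq[OF i \<omega> less.prems] s1_def s2_def s3_def noise_def dir_def
      by (simp add: sum_subtractf sum_constant_scaleR algebra_simps del: sum_constant)
    then have "(norm (y i t l \<omega> - x t \<omega>))\<^sup>2 = \<eta>\<^sup>2 * (norm (s1 + s2 + s3))\<^sup>2"
      by (simp only: norm_minus_cancel norm_scaleR power_mult_distrib power2_abs)
    also have "\<dots> \<le> \<eta>\<^sup>2 * (3 * ((norm s1)\<^sup>2 + real l * (L\<^sup>2 * (\<Sum>r<l. (norm (y i t r \<omega> - x t \<omega>))\<^sup>2))
        + (norm s3)\<^sup>2))"
    proof (intro mult_left_mono zero_le_power2)
      have "(norm s2)\<^sup>2 \<le> real l * (\<Sum>r<l. (norm (grad (Fi i) (y i t r \<omega>) - grad (Fi i) (x t \<omega>)))\<^sup>2)"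
        unfolding s2_def using norm_sum_power2_le[of _ "{..<l}"] by simp
      also have "\<dots> \<le> real l * (\<Sum>r<l. (L * norm (y i t r \<omega> - x t \<omega>))\<^sup>2)"
        using i by (intro mult_left_mono sum_mono power_mono lipschitz_grad L_smooth_node) auto
      finally have s2: "(norm s2)\<^sup>2 \<le> real l * (L\<^sup>2 * (\<Sum>r<l. (norm (y i t r \<omega> - x t \<omega>))\<^sup>2))"
        by (simp add: power_mult_distrib sum_distrib_left)
      have "(norm (s1 + s2 + s3))\<^sup>2 \<le> 3 * ((norm s1)\<^sup>2 + (norm s2)\<^sup>2 + (norm s3)\<^sup>2)"
        using norm_sum_power2_le[of "\<lambda>k. if k = 0 then s1 else if k = 1 then s2 else s3" "{0, 1, 2 :: nat}"]
        by (simp add: add.assoc)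
      also have "\<dots> \<le> 3 * ((norm s1)\<^sup>2
          + real l * (L\<^sup>2 * (\<Sum>r<l. (norm (y i t r \<omega> - x t \<omega>))\<^sup>2)) + (norm s3)\<^sup>2)"
        by (intro mult_left_mono add_mono order_refl s2) simp
      finally show "(norm (s1 + s2 + s3))\<^sup>2 \<le> \<dots>" .
    qed
    also have "\<dots> = rhs \<omega>"
      unfolding rhs_def s1_def s3_def by (simp add: power_mult_distrib)
    finally show ?thesis .
  qed
  have int1: "integrable P (\<lambda>\<omega>. (norm (y i t r \<omega> - x t \<omega>))\<^sup>2)" if "r \<le> H" for r
    using i that by (intro ess_bounded_integrable ess_bounded_intros)
  have int2: "integrable P (\<lambda>\<omega>. (norm (\<Sum>r<l. noise i t r \<omega>))\<^sup>2)"
    using i less.prems by (intro ess_bounded_integrable ess_bounded_intros) auto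
  have int3: "integrable P (\<lambda>\<omega>. \<Sum>r<l. (norm (y i t r \<omega> - x t \<omega>))\<^sup>2)"
    using less.prems by (intro Bochner_Integration.integrable_sum int1) auto
  have irhs: "integrable P rhs"
    unfolding rhs_def
    by (intro Bochner_Integration.integrable_add integrable_mult_right int2 int3 dir_sq_integrable i)
  have "u l \<le> (\<integral>\<omega>. rhs \<omega> \<partial>P)"
    unfolding u_def by (rule integral_mono[OF int1[OF less.prems] irhs pt])
  also have "\<dots> = 3 * \<eta>\<^sup>2 * ((\<integral>\<omega>. (norm (\<Sum>r<l. noise i t r \<omega>))\<^sup>2 \<partial>P) + real l * (L\<^sup>2 * (\<Sum>r<l. u r))
      + (real l)\<^sup>2 * (\<integral>\<omega>. (norm (dir i t \<omega>))\<^sup>2 \<partial>P))"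
  proof -
    have "(\<integral>\<omega>. (\<Sum>r<l. (norm (y i t r \<omega> - x t \<omega>))\<^sup>2) \<partial>P) = (\<Sum>r<l. u r)"
      unfolding u_def using less.prems by (intro Bochner_Integration.integral_sum int1) auto
    then show ?thesis
      unfolding rhs_def using int2 int3 dir_sq_integrable[OF i, of t] by simp
  qed
  also have "\<dots> \<le> 3 * \<eta>\<^sup>2 * (real H * (vsq / real b) + real H * (L\<^sup>2 * (real H * drift t)) + (real H)\<^sup>2 * d)"
  proof (intro mult_left_mono[of _ _ "3 * \<eta>\<^sup>2"] add_mono)
    have "(\<integral>\<omega>. (norm (\<Sum>r<l. noise i t r \<omega>))\<^sup>2 \<partial>P) \<le> real l * (vsq / real b)"
      by (rule noise_sum_variance_local[OF i less.prems])
    also have "\<dots> \<le> real H * (vsq / real b)"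
      using H vsq_nonneg by (intro mult_right_mono) auto
    finally show "(\<integral>\<omega>. (norm (\<Sum>r<l. noise i t r \<omega>))\<^sup>2 \<partial>P) \<le> real H * (vsq / real b)" .
    have "(\<Sum>r<l. u r) \<le> real (card {..<l}) * drift t"
      using less unfolding u_def by (intro sum_bounded_above) auto
    also have "\<dots> \<le> real H * drift t"
      using H drift_nonneg by (intro mult_right_mono) auto
    finally show "real l * (L\<^sup>2 * (\<Sum>r<l. u r)) \<le> real H * (L\<^sup>2 * (real H * drift t))"
      using H by (intro mult_mono mult_left_mono) (auto simp: u_def intro!: mult_nonneg_nonneg sum_nonneg)
    show "(real l)\<^sup>2 * (\<integral>\<omega>. (norm (dir i t \<omega>))\<^sup>2 \<partial>P) \<le> (real H)\<^sup>2 * d"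
      using H dir_sq_le[OF i, of t] by (intro mult_mono power_mono) (auto simp: d_def)
  qed simp
  also have "\<dots> = 15 / 16 * drift t + 3 * (\<theta>\<^sup>2 * drift t)"
  proof -
    have "\<eta>\<^sup>2 * (real H * (L\<^sup>2 * (real H * drift t))) = \<theta>\<^sup>2 * drift t"
      "\<eta>\<^sup>2 * ((real H)\<^sup>2 * d) = \<theta>\<^sup>2 / L\<^sup>2 * d"
      "\<eta>\<^sup>2 * (real H * (vsq / real b)) = \<theta>\<^sup>2 / L\<^sup>2 * (vsq / (real H * real b))"
      using H L_pos by (simp_all add: power_divide power_mult_distrib power2_eq_square)
    note eqs = this
    define w1 where "w1 = \<theta>\<^sup>2 / L\<^sup>2 * (vsq / (real H * real b))"
    define w2 where "w2 = \<theta>\<^sup>2 / L\<^sup>2 * d"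
    have expand: "3 * \<eta>\<^sup>2 * (p1 + p2 + p3) = 3 * (\<eta>\<^sup>2 * p1) + 3 * (\<eta>\<^sup>2 * p2) + 3 * (\<eta>\<^sup>2 * p3)" for p1 p2 p3
      by (simp only: distrib_left mult.assoc)
    have "15 / 16 * drift t = 3 * w1 + 3 * w2"
      by (simp add: drift_def d_def w1_def w2_def algebra_simps)
    then show ?thesis
      unfolding expand eqs w1_def[symmetric] w2_def[symmetric] by simp
  qed
  also have "\<dots> \<le> drift t"
    using mult_right_mono[OF less_imp_le[OF \<theta>(3)] drift_nonneg[of t]] drift_nonneg[of t] by simp
  finally show ?case by (simp add: u_def)
qed

subsection \<open>The control error\<close>

lemma control_error_step:
  assumes i: "i < n"
  shows "(\<integral>\<omega>. (norm (err i (Suc t) \<omega>))\<^sup>2 \<partial>P) \<le> 2 * vsq / (real H * real b) + 8 * L\<^sup>2 * drift t"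
proof -
  have H: "real H > 0" "real b > 0" using H_ge_1 b_ge_1 by auto
  define D where "D k l \<omega> = (norm (y k t l \<omega> - x t \<omega>))\<^sup>2" for k l \<omega>
  define rhs where "rhs \<omega> = 2 * ((1 / real H)\<^sup>2 * (norm (\<Sum>l<H. noise i t l \<omega>))\<^sup>2)
      + 4 * L\<^sup>2 * ((1 / real H) * (\<Sum>l<H. D i l \<omega>)) + 4 * L\<^sup>2 * ((1 / real n) * (\<Sum>k<n. D k H \<omega>))" for \<omega>
  have pt: "(norm (err i (Suc t) \<omega>))\<^sup>2 \<le> rhs \<omega>" if \<omega>: "\<omega> \<in> space P" for \<omega>
  proof -
    define z where "z = x (Suc t) \<omega>"
    define s1 where "s1 = (1 / real H) *\<^sub>R (\<Sum>l<H. noise i t l \<omega>)"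
    define s2 where "s2 = (1 / real H) *\<^sub>R (\<Sum>l<H. grad (Fi i) (y i t l \<omega>) - grad (Fi i) z)"
    define w where "w = (1 / real n) * (\<Sum>k<n. D k H \<omega>)"
    have "err i (Suc t) \<omega> = s1 + s2"
      using H unfolding err_def c_Suc_eq[OF i \<omega>] s1_def s2_def z_def noise_def
      by (simp add: sum_subtractf sum_constant_scaleR scaleR_diff_right del: sum_constant)
    then have "(norm (err i (Suc t) \<omega>))\<^sup>2 \<le> 2 * (norm s1)\<^sup>2 + 2 * (norm s2)\<^sup>2"
      by (simp only: norm_add_power2_le)
    moreover have "(norm s1)\<^sup>2 = (1 / real H)\<^sup>2 * (norm (\<Sum>l<H. noise i t l \<omega>))\<^sup>2"
      by (simp add: s1_def power_mult_distrib power_divide)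
    moreover have "(norm s2)\<^sup>2 \<le> 2 * L\<^sup>2 * ((1 / real H) * (\<Sum>l<H. D i l \<omega>)) + 2 * L\<^sup>2 * w"
    proof -
      have "z - x t \<omega> = (1 / real n) *\<^sub>R (\<Sum>k<n. y k t H \<omega> - x t \<omega>)"
        using alg_x[OF \<omega>, of t] by (simp add: z_def)
      then have zx: "(norm (z - x t \<omega>))\<^sup>2 \<le> w"
        unfolding w_def D_def by (simp only: norm_average_power2_le)
      have "(norm s2)\<^sup>2 \<le> (1 / real H) * (\<Sum>l<H. (norm (grad (Fi i) (y i t l \<omega>) - grad (Fi i) z))\<^sup>2)"
        unfolding s2_def by (rule norm_average_power2_le)
      also have "\<dots> \<le> (1 / real H) * (\<Sum>l<H. 2 * L\<^sup>2 * D i l \<omega> + 2 * L\<^sup>2 * w)"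
      proof (intro mult_left_mono sum_mono)
        fix l
        have "(norm (grad (Fi i) (y i t l \<omega>) - grad (Fi i) z))\<^sup>2 \<le> (L * norm (y i t l \<omega> - z))\<^sup>2"
          using i by (intro power_mono lipschitz_grad L_smooth_node) auto
        also have "\<dots> = L\<^sup>2 * (norm ((y i t l \<omega> - x t \<omega>) + (x t \<omega> - z)))\<^sup>2"
          by (simp add: power_mult_distrib)
        also have "\<dots> \<le> L\<^sup>2 * (2 * D i l \<omega> + 2 * (norm (x t \<omega> - z))\<^sup>2)"
          unfolding D_def by (intro mult_left_mono norm_add_power2_le) simp
        also have "\<dots> \<le> L\<^sup>2 * (2 * D i l \<omega> + 2 * w)"
          using zx by (intro mult_left_mono add_left_mono) (auto simp: norm_minus_commute)
        finally show "(norm (grad (Fi i) (y i t l \<omega>) - grad (Fi i) z))\<^sup>2 \<le> 2 * L\<^sup>2 * D i l \<omega> + 2 * L\<^sup>2 * w"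
          by (simp add: algebra_simps)
      qed simp
      also have "\<dots> = 2 * L\<^sup>2 * ((1 / real H) * (\<Sum>l<H. D i l \<omega>)) + 2 * L\<^sup>2 * w"
        using H by (simp add: sum.distrib sum_distrib_left field_simps)
      finally show ?thesis .
    qed
    ultimately show ?thesis unfolding rhs_def w_def by linarith
  qed
  have D: "integrable P (D k l)" if "k < n" "l \<le> H" for k l
    unfolding D_def using that by (intro ess_bounded_integrable ess_bounded_intros)
  have Dle: "(\<integral>\<omega>. D k l \<omega> \<partial>P) \<le> drift t" if "k < n" "l \<le> H" for k l
    unfolding D_def using that by (rule drift_bound)
  have i1: "integrable P (\<lambda>\<omega>. (norm (\<Sum>l<H. noise i t l \<omega>))\<^sup>2)"
    using i by (intro ess_bounded_integrable ess_bounded_intros) auto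
  have i2: "integrable P (\<lambda>\<omega>. \<Sum>l<H. D i l \<omega>)" "integrable P (\<lambda>\<omega>. \<Sum>k<n. D k H \<omega>)"
    using i by (auto intro!: Bochner_Integration.integrable_sum D)
  have irhs: "integrable P rhs"
    unfolding rhs_def by (intro Bochner_Integration.integrable_add integrable_mult_right i1 i2)
  have "(\<integral>\<omega>. (norm (err i (Suc t) \<omega>))\<^sup>2 \<partial>P) \<le> (\<integral>\<omega>. rhs \<omega> \<partial>P)"
    by (rule integral_mono[OF err_sq_integrable[OF i] irhs pt])
  also have "\<dots> = 2 * ((1 / real H)\<^sup>2 * (\<integral>\<omega>. (norm (\<Sum>l<H. noise i t l \<omega>))\<^sup>2 \<partial>P))
      + 4 * L\<^sup>2 * ((1 / real H) * (\<Sum>l<H. \<integral>\<omega>. D i l \<omega> \<partial>P)) + 4 * L\<^sup>2 * ((1 / real n) * (\<Sum>k<n. \<integral>\<omega>. D k H \<omega> \<partial>P))"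
  proof -
    have "(\<integral>\<omega>. (\<Sum>l<H. D i l \<omega>) \<partial>P) = (\<Sum>l<H. \<integral>\<omega>. D i l \<omega> \<partial>P)"
      "(\<integral>\<omega>. (\<Sum>k<n. D k H \<omega>) \<partial>P) = (\<Sum>k<n. \<integral>\<omega>. D k H \<omega> \<partial>P)"
      using i by (auto intro!: Bochner_Integration.integral_sum D)
    then show ?thesis unfolding rhs_def using i1 i2 by simp
  qed
  also have "\<dots> \<le> 2 * ((1 / real H)\<^sup>2 * (real H * (vsq / real b))) + 4 * L\<^sup>2 * drift t + 4 * L\<^sup>2 * drift t"
    using i n_ge_1 H_ge_1
    by (intro add_mono mult_left_mono noise_sum_variance_local average_const_le Dle) auto
  also have "\<dots> = 2 * vsq / (real H * real b) + 8 * L\<^sup>2 * drift t"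
    using H by (simp add: power2_eq_square)
  finally show ?thesis .
qed

lemma q_step:
  "q (Suc t) \<le> 6 * vsq / (real H * real b) + 144 * L * \<theta>\<^sup>2 * gap t + 288 * \<theta>\<^sup>2 * q t"
proof -
  define w where "w = vsq / (real H * real b)"
  have w: "w \<ge> 0" using vsq_nonneg by (simp add: w_def)
  have "{..<n} \<noteq> {}" using n_ge_1 by (auto simp: lessThan_empty_iff)
  then have "q (Suc t) \<le> 2 * w + 8 * L\<^sup>2 * drift t"
    unfolding q_def w_def using control_error_step by (subst Max_le_iff) auto
  also have "\<dots> = 2 * w + 128 / 5 * \<theta>\<^sup>2 * (w + 4 * L * gap t + 8 * q t)"
    using L_pos by (simp add: drift_def w_def)
  also have "\<dots> \<le> 6 * w + 144 * L * \<theta>\<^sup>2 * gap t + 288 * \<theta>\<^sup>2 * q t"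
  proof -
    have "\<theta>\<^sup>2 * w \<le> 1 / 288 * w" using \<theta>(3) w by (intro mult_right_mono) auto
    moreover have "0 \<le> L * (\<theta>\<^sup>2 * gap t)" "0 \<le> \<theta>\<^sup>2 * q t"
      using L_pos gap_nonneg q_nonneg by auto
    ultimately show ?thesis using w by (simp add: algebra_simps)
  qed
  finally show ?thesis by (simp add: w_def)
qed

lemma q_bounded:
  "q t \<le> max (q 0) ((6 * vsq / (real H * real b) + 144 * L * \<theta>\<^sup>2 * (L * R\<^sup>2 / 2)) / (1 - 288 * \<theta>\<^sup>2))"
proof (rule affine_recursion_bounded)
  fix t
  have "144 * L * \<theta>\<^sup>2 * gap t \<le> 144 * L * \<theta>\<^sup>2 * (L * R\<^sup>2 / 2)"
    using L_pos by (intro mult_left_mono gap_le) auto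
  then show "q (Suc t) \<le> 6 * vsq / (real H * real b) + 144 * L * \<theta>\<^sup>2 * (L * R\<^sup>2 / 2) + 288 * \<theta>\<^sup>2 * q t"
    using q_step[of t] by linarith
qed (use \<theta> in auto)

subsection \<open>Descent over one round\<close>

lemma integral_power2_le:
  fixes f :: "'w \<Rightarrow> real"
  assumes "integrable P f" "integrable P (\<lambda>\<omega>. (f \<omega>)\<^sup>2)"
  shows "(\<integral>\<omega>. f \<omega> \<partial>P)\<^sup>2 \<le> (\<integral>\<omega>. (f \<omega>)\<^sup>2 \<partial>P)"
  using variance_eq[OF assms] variance_positive[of f] by linarith

text \<open>The averaged iterates perform biased stochastic gradient descent on \<open>F\<close>. Conditioning on all
  earlier local steps of all nodes makes the noise of each step centered, so that
  no noise-bias cross term appears.\<close>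

lemma round_descent:
  assumes \<kappa>: "\<kappa> \<ge> 0" and bias: "\<And>l \<omega>. good \<omega> \<Longrightarrow> l \<le> H \<Longrightarrow>
      (norm ((1 / real n) *\<^sub>R (\<Sum>i<n. grad (Fi i) (y i t l \<omega>)) - grad F (ybar t l \<omega>)))\<^sup>2
        \<le> \<kappa> * ((1 / real n) * (\<Sum>i<n. (norm (y i t l \<omega> - x t \<omega>))\<^sup>2))"
  shows "gap (Suc t) \<le> T_map (\<theta> / (2 * L * R\<^sup>2)) (gap t) + \<theta> / (2 * L) * \<kappa> * drift t
      + \<theta>\<^sup>2 / (2 * L * real n * real H) * (vsq / real b)"
proof -
  have n: "real n > 0" and H: "real H > 0" and b: "real b > 0" using n_ge_1 H_ge_1 b_ge_1 by auto
  define h where "h l \<omega> = F (ybar t l \<omega>) - F xs" for l \<omega>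
  define u where "u l = (\<integral>\<omega>. h l \<omega> \<partial>P)" for l
  define s where "s = \<eta> / 2 * (\<kappa> * drift t) + L * \<eta>\<^sup>2 / 2 * (vsq / (real n * real b))"
  have eh: "ess_bounded (h l)" if "l \<le> H" for l
    unfolding h_def[abs_def] using that
    by (intro ess_bounded_gap ybar_in_ball ess_bounded_measurable ess_bounded_ybar)
  have ih: "integrable P (h l)" "integrable P (\<lambda>\<omega>. (h l \<omega>)\<^sup>2)" if "l \<le> H" for l
    using ess_bounded_integrable[OF eh[OF that]]
      ess_bounded_integrable[OF ess_bounded_inner[OF eh[OF that] eh[OF that]]]
    by (simp_all add: power2_eq_square)
  have u0: "u l \<ge> 0" for l
    unfolding u_def h_def using F_min by (intro integral_nonneg_AE) auto
  have \<eta>L: "\<eta> * L \<le> 1"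
  proof -
    have "\<theta> / real H \<le> 1 / 1" using \<theta> H_ge_1 by (intro frac_le) auto
    then show ?thesis using L_pos by simp
  qed
  have step: "u (Suc l) \<le> u l - \<eta> / (2 * R\<^sup>2) * (u l)\<^sup>2 + s" if l: "l < H" for l
  proof -
    define G where "G \<omega> = (1 / real n) *\<^sub>R (\<Sum>i<n. grad (Fi i) (y i t l \<omega>))" for \<omega>
    define r where "r \<omega> = G \<omega> - grad F (ybar t l \<omega>)" for \<omega>
    define \<xi> where "\<xi> \<omega> = (1 / real n) *\<^sub>R (\<Sum>i<n. noise i t l \<omega>)" for \<omega>
    define W where "W \<omega> = (L * \<eta>\<^sup>2) *\<^sub>R G \<omega> - \<eta> *\<^sub>R grad F (ybar t l \<omega>)" for \<omega>
    define D where "D i \<omega> = (norm (y i t l \<omega> - x t \<omega>))\<^sup>2" for i \<omega>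
    have lH: "l \<le> H" using l by simp
    have eF: "ess_bounded (\<lambda>\<omega>. grad F (ybar t l \<omega>))"
      using lH by (intro ess_bounded_grad L_smooth_global ybar_in_ball ess_bounded_measurable ess_bounded_ybar)
    have eG: "ess_bounded G" unfolding G_def using lH by (intro ess_bounded_intros) auto
    have er: "ess_bounded r" unfolding r_def by (intro ess_bounded_diff eG eF)
    have e\<xi>: "ess_bounded \<xi>" unfolding \<xi>_def using l by (intro ess_bounded_intros) auto
    have eW: "ess_bounded W" unfolding W_def by (intro ess_bounded_diff ess_bounded_scaleR eG eF)
    have eD: "ess_bounded (D i)" if "i < n" for i unfolding D_def using that lH by (intro ess_bounded_intros)
    have Wnoise: "(\<integral>\<omega>. inner (W \<omega>) (noise i t l \<omega>) \<partial>P) = 0" if i: "i < n" for i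
    proof (rule noise_orthogonal[OF i l _ eW])
      have "ybar t l \<in> borel_measurable (known t (steps - {(i, l)}))"
        using lH by (intro ybar_known) auto
      from measurable_compose[OF this grad_borel[OF L_smooth_global]]
      show "W \<in> borel_measurable (known t (steps - {(i, l)}))"
        unfolding W_def G_def using lH
        by (intro borel_measurable_diff borel_measurable_scaleR borel_measurable_const
            borel_measurable_sum grad_y_known) auto
    qed
    have W\<xi>: "(\<integral>\<omega>. inner (W \<omega>) (\<xi> \<omega>) \<partial>P) = 0"
    proof -
      have "integrable P (\<lambda>\<omega>. inner (W \<omega>) (noise i t l \<omega>))" if "i < n" for i
        using that l by (intro ess_bounded_integrable ess_bounded_inner eW ess_bounded_noise)
      then show ?thesis
        using Wnoise by (simp add: \<xi>_def inner_sum_right Bochner_Integration.integral_sum)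
    qed
    have r2: "(\<integral>\<omega>. (norm (r \<omega>))\<^sup>2 \<partial>P) \<le> \<kappa> * drift t"
    proof -
      have "(\<integral>\<omega>. (norm (r \<omega>))\<^sup>2 \<partial>P) \<le> (\<integral>\<omega>. \<kappa> * ((1 / real n) * (\<Sum>i<n. D i \<omega>)) \<partial>P)"
      proof (rule integral_mono_AE)
        show "AE \<omega> in P. (norm (r \<omega>))\<^sup>2 \<le> \<kappa> * ((1 / real n) * (\<Sum>i<n. D i \<omega>))"
          using AE_good by eventually_elim (unfold r_def G_def D_def, rule bias[OF _ lH])
        show "integrable P (\<lambda>\<omega>. \<kappa> * ((1 / real n) * (\<Sum>i<n. D i \<omega>)))"
          by (intro integrable_mult_right Bochner_Integration.integrable_sum ess_bounded_integrable eD) simp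
      qed (intro ess_bounded_integrable ess_bounded_norm_sq er)
      also have "\<dots> = \<kappa> * ((1 / real n) * (\<Sum>i<n. \<integral>\<omega>. D i \<omega> \<partial>P))"
        using ess_bounded_integrable[OF eD] by (simp add: Bochner_Integration.integral_sum)
      also have "\<dots> \<le> \<kappa> * drift t"
        unfolding D_def using \<kappa> n_ge_1 lH by (intro mult_left_mono average_const_le drift_bound)
      finally show ?thesis .
    qed
    have \<xi>2: "(\<integral>\<omega>. (norm (\<xi> \<omega>))\<^sup>2 \<partial>P) \<le> vsq / (real n * real b)"
    proof -
      have "(\<integral>\<omega>. (norm (\<xi> \<omega>))\<^sup>2 \<partial>P) = (1 / real n)\<^sup>2 * (\<integral>\<omega>. (norm (\<Sum>i<n. noise i t l \<omega>))\<^sup>2 \<partial>P)"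
        by (simp add: \<xi>_def power_mult_distrib power_divide)
      also have "\<dots> \<le> (1 / real n)\<^sup>2 * (real n * (vsq / real b))"
        by (intro mult_left_mono noise_sum_variance_nodes l) simp
      finally show ?thesis using n by (simp add: power2_eq_square)
    qed
    have pt: "AE \<omega> in P. h (Suc l) \<omega> \<le> h l \<omega> - \<eta> / (2 * R\<^sup>2) * (h l \<omega>)\<^sup>2 + \<eta> / 2 * (norm (r \<omega>))\<^sup>2
        + L * \<eta>\<^sup>2 / 2 * (norm (\<xi> \<omega>))\<^sup>2 + inner (W \<omega>) (\<xi> \<omega>)"
      using AE_good
    proof eventually_elim
      fix \<omega> assume g: "good \<omega>"
      have "(1 / real n) *\<^sub>R (\<Sum>i<n. sg i t l \<omega>) = G \<omega> + \<xi> \<omega>"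
        by (simp add: G_def \<xi>_def noise_def sum_subtractf scaleR_diff_right)
      then have "ybar t (Suc l) \<omega> = ybar t l \<omega> - \<eta> *\<^sub>R (grad F (ybar t l \<omega>) + r \<omega> + \<xi> \<omega>)"
        using ybar_Suc[OF l, of \<omega> t] g by (simp add: r_def)
      moreover have "grad F (ybar t l \<omega>) + r \<omega> = G \<omega>" by (simp add: r_def)
      ultimately show "h (Suc l) \<omega> \<le> h l \<omega> - \<eta> / (2 * R\<^sup>2) * (h l \<omega>)\<^sup>2 + \<eta> / 2 * (norm (r \<omega>))\<^sup>2
          + L * \<eta>\<^sup>2 / 2 * (norm (\<xi> \<omega>))\<^sup>2 + inner (W \<omega>) (\<xi> \<omega>)"
        using biased_gradient_step[OF less_imp_le[OF \<eta>_pos] \<eta>L ybar_in_ball[OF g lH], of t "r \<omega>" "\<xi> \<omega>"]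
        unfolding h_def W_def by simp
    qed
    have ir: "integrable P (\<lambda>\<omega>. (norm (r \<omega>))\<^sup>2)" and i\<xi>: "integrable P (\<lambda>\<omega>. (norm (\<xi> \<omega>))\<^sup>2)"
      and iW: "integrable P (\<lambda>\<omega>. inner (W \<omega>) (\<xi> \<omega>))"
      using er e\<xi> eW by (auto intro!: ess_bounded_integrable ess_bounded_norm_sq ess_bounded_inner)
    have "u (Suc l) \<le> (\<integral>\<omega>. h l \<omega> - \<eta> / (2 * R\<^sup>2) * (h l \<omega>)\<^sup>2 + \<eta> / 2 * (norm (r \<omega>))\<^sup>2
        + L * \<eta>\<^sup>2 / 2 * (norm (\<xi> \<omega>))\<^sup>2 + inner (W \<omega>) (\<xi> \<omega>) \<partial>P)"
      unfolding u_def using l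
      by (intro integral_mono_AE[OF ih(1) _ pt] Bochner_Integration.integrable_add
          Bochner_Integration.integrable_diff integrable_mult_right ih ir i\<xi> iW) auto
    also have "\<dots> = u l - \<eta> / (2 * R\<^sup>2) * (\<integral>\<omega>. (h l \<omega>)\<^sup>2 \<partial>P) + \<eta> / 2 * (\<integral>\<omega>. (norm (r \<omega>))\<^sup>2 \<partial>P)
        + L * \<eta>\<^sup>2 / 2 * (\<integral>\<omega>. (norm (\<xi> \<omega>))\<^sup>2 \<partial>P)"
      unfolding u_def using ih[OF lH] ir i\<xi> iW W\<xi> by simp
    also have "\<dots> \<le> u l - \<eta> / (2 * R\<^sup>2) * (u l)\<^sup>2 + \<eta> / 2 * (\<kappa> * drift t)
        + L * \<eta>\<^sup>2 / 2 * (vsq / (real n * real b))"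
    proof -
      have "0 \<le> \<eta> / (2 * R\<^sup>2)" "0 \<le> \<eta> / 2" "0 \<le> L * \<eta>\<^sup>2 / 2"
        using \<theta> L_pos by (auto intro!: divide_nonneg_nonneg mult_nonneg_nonneg)
      then show ?thesis
        using integral_power2_le[OF ih[OF lH]] unfolding u_def
        by (intro add_mono diff_left_mono mult_left_mono r2 \<xi>2 order_refl)
    qed
    finally show ?thesis by (simp add: s_def)
  qed
  have s0: "s \<ge> 0"
    unfolding s_def using \<eta>_pos L_pos \<kappa> drift_nonneg vsq_nonneg by (intro add_nonneg_nonneg mult_nonneg_nonneg) auto
  have "u H \<le> T_map (real H * (\<eta> / (2 * R\<^sup>2))) (u 0) + real H * s"
  proof (rule T_map_iterate[where N = H])
    show "0 \<le> \<eta> / (2 * R\<^sup>2)" using \<theta> L_pos by (auto intro!: divide_nonneg_nonneg mult_nonneg_nonneg)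
  qed (use s0 u0 step in auto)
  also have "real H * (\<eta> / (2 * R\<^sup>2)) = \<theta> / (2 * L * R\<^sup>2)"
    using H by simp
  also have "real H * s = \<theta> / (2 * L) * \<kappa> * drift t + \<theta>\<^sup>2 / (2 * L * real n * real H) * (vsq / real b)"
    unfolding s_def using H L_pos n b by (simp add: power2_eq_square field_simps)
  also have "u H = gap (Suc t)"
    unfolding u_def h_def gap_def by (intro Bochner_Integration.integral_cong) (auto simp: ybar_H)
  also have "u 0 = gap t"
    unfolding u_def h_def gap_def by (intro Bochner_Integration.integral_cong) (auto simp: ybar_0)
  finally show ?thesis by simp
qed

end

section \<open>The convergence bounds\<close>

theorem theorem3p4:
  fixes P :: "'w measure"
    and n H b :: nat
    and m :: "nat \<Rightarrow> nat"
    and \<phi> :: "nat \<Rightarrow> nat \<Rightarrow> real ^ 'd \<Rightarrow> real"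
    and L R \<theta> \<H> M :: real
    and xs :: "real ^ 'd"
    and B :: "nat \<Rightarrow> nat \<Rightarrow> nat \<Rightarrow> 'w \<Rightarrow> nat set"
    and x :: "nat \<Rightarrow> 'w \<Rightarrow> real ^ 'd"
    and y :: "nat \<Rightarrow> nat \<Rightarrow> nat \<Rightarrow> 'w \<Rightarrow> real ^ 'd"
    and c :: "nat \<Rightarrow> nat \<Rightarrow> 'w \<Rightarrow> real ^ 'd"
    and cbar :: "nat \<Rightarrow> 'w \<Rightarrow> real ^ 'd"
    and Fi F Bxs sg D \<G>
    and g q \<Delta>sq :: "nat \<Rightarrow> real"
    and fbar v \<eta> Aq Bq Cq K a al qbar \<beta> \<delta> :: real
  \<comment> \<open>problem data\<close>
  defines "Fi \<equiv> node_obj m \<phi>"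
    and "F \<equiv> global_obj n m \<phi>"
    and "Bxs \<equiv> cball xs R"
    and "fbar \<equiv> L * R\<^sup>2 / 2"
    and "v \<equiv> sqrt (MAX i\<in>{..<n}. node_var m \<phi> xs R i)"
    and "\<eta> \<equiv> \<theta> / (L * real H)"
  \<comment> \<open>\<open>sg i t l\<close>: minibatch gradient; \<open>D i t\<close>: model update; \<open>\<G> i t l\<close>: local sigma-algebra\<close>
  defines "sg \<equiv> \<lambda>i t l \<omega>. (1 / real b) *\<^sub>R (\<Sum>j\<in>B i t l \<omega>. grad (\<phi> i j) (y i t l \<omega>))"
    and "D \<equiv> \<lambda>i t \<omega>. y i t H \<omega> - x t \<omega>"
    and "\<G> \<equiv> local_alg P n H (x 0) (\<lambda>i. c i 0) B"
    and "g \<equiv> \<lambda>t. \<integral>\<omega>. F (x t \<omega>) - F xs \<partial>P"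
    and "q \<equiv> \<lambda>t. MAX i\<in>{..<n}. \<integral>\<omega>. (norm (c i t \<omega> - grad (Fi i) (x t \<omega>)))\<^sup>2 \<partial>P"
  \<comment> \<open>constants of the conclusion\<close>
  defines "Aq \<equiv> 6 * v\<^sup>2 / (real H * real b)"
    and "Bq \<equiv> 144 * L * \<theta>\<^sup>2"
    and "Cq \<equiv> 288 * \<theta>\<^sup>2"
    and "K \<equiv> (\<H> + M * R)\<^sup>2"
    and "a \<equiv> \<theta> / (2 * L * R\<^sup>2)"
    and "al \<equiv> \<theta> / (2 * L * R\<^sup>2 * (1 + \<theta> / 4))"
    and "\<Delta>sq \<equiv> \<lambda>t. 96 * \<theta>\<^sup>2 / L * g t + 32 * \<theta>\<^sup>2 * v\<^sup>2 / (L\<^sup>2 * real H * real b)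
                   + 192 * \<theta>\<^sup>2 / L\<^sup>2 * q t"
    and "qbar \<equiv> max (q 0) ((Aq + Bq * fbar) / (1 - Cq))"
    and "\<beta> \<equiv> 2 * \<theta> / L * K * (96 * \<theta>\<^sup>2 / L)"
    and "\<delta> \<equiv> 2 * \<theta> / L * K * (32 * \<theta>\<^sup>2 * v\<^sup>2 / (L\<^sup>2 * real H * real b) + 192 * \<theta>\<^sup>2 / L\<^sup>2 * qbar)
              + \<theta>\<^sup>2 / (2 * L * real n * real H) * (v\<^sup>2 / real b)"
  assumes prob: "prob_space P"
    and sizes: "n \<ge> 1" "H \<ge> 1" "b \<ge> 1" "\<And>i. i < n \<Longrightarrow> m i \<ge> 1"
    and params: "L > 0" "R > 0" "0 < \<theta>" "\<theta> \<le> 1" "288 * \<theta>\<^sup>2 < 1"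
    and conv: "\<And>i j. i < n \<Longrightarrow> j < m i \<Longrightarrow> convex_on UNIV (\<phi> i j)"
    and smooth: "\<And>i j. i < n \<Longrightarrow> j < m i \<Longrightarrow> L_smooth L (\<phi> i j)"
    and minimizer: "is_arg_min F (\<lambda>_. True) xs"
    \<comment> \<open>initial state and minibatches\<close>
    and init_x: "x 0 \<in> borel_measurable P"
    and init_c: "\<And>i. i < n \<Longrightarrow> c i 0 \<in> borel_measurable P"
    and init_c_sq: "\<And>i. i < n \<Longrightarrow> integrable P (\<lambda>\<omega>. (norm (c i 0 \<omega>))\<^sup>2)"
    and batch: "\<And>i t l. i < n \<Longrightarrow> l < H \<Longrightarrow>
          B i t l \<in> measurable P (count_space {S. S \<subseteq> {..<m i} \<and> card S = b})"
    \<comment> \<open>the algorithm\<close>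
    and alg_c0: "\<And>\<omega>. \<omega> \<in> space P \<Longrightarrow> cbar 0 \<omega> = (1 / real n) *\<^sub>R (\<Sum>i<n. c i 0 \<omega>)"
    and alg_y0: "\<And>i t \<omega>. i < n \<Longrightarrow> \<omega> \<in> space P \<Longrightarrow> y i t 0 \<omega> = x t \<omega>"
    and alg_y: "\<And>i t l \<omega>. i < n \<Longrightarrow> l < H \<Longrightarrow> \<omega> \<in> space P \<Longrightarrow>
          y i t (Suc l) \<omega> = y i t l \<omega> - \<eta> *\<^sub>R (sg i t l \<omega> - c i t \<omega> + cbar t \<omega>)"
    and alg_c: "\<And>i t \<omega>. i < n \<Longrightarrow> \<omega> \<in> space P \<Longrightarrow>
          c i (Suc t) \<omega> = c i t \<omega> - cbar t \<omega> + (1 / (real H * \<eta>)) *\<^sub>R (x t \<omega> - y i t H \<omega>)"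
    and alg_x: "\<And>t \<omega>. \<omega> \<in> space P \<Longrightarrow>
          x (Suc t) \<omega> = x t \<omega> + (1 / real n) *\<^sub>R (\<Sum>i<n. D i t \<omega>)"
    and alg_cbar: "\<And>t \<omega>. \<omega> \<in> space P \<Longrightarrow>
          cbar (Suc t) \<omega> = cbar t \<omega> + (1 / real n) *\<^sub>R (\<Sum>i<n. c i (Suc t) \<omega> - c i t \<omega>)"
    \<comment> \<open>standing assumptions\<close>
    and confined: "AE \<omega> in P. \<forall>t. x t \<omega> \<in> Bxs \<and> (\<forall>i<n. \<forall>l\<le>H. y i t l \<omega> \<in> Bxs)"
    and indep: "\<And>i t l. i < n \<Longrightarrow> l < H \<Longrightarrow>
          cond_indep_vars P (\<G> i t l)
            (\<lambda>(k, r). count_space {S. S \<subseteq> {..<m k} \<and> card S = b})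
            (\<lambda>(k, r). B k t r) ({..<n} \<times> {..<H})"
    and unbiased: "\<And>i t l. i < n \<Longrightarrow> l < H \<Longrightarrow>
          AE \<omega> in P. vec_cond_exp P (\<G> i t l) (sg i t l) \<omega> = grad (Fi i) (y i t l \<omega>)"
    and variance: "\<And>i t l. i < n \<Longrightarrow> l < H \<Longrightarrow>
          AE \<omega> in P. real_cond_exp P (\<G> i t l)
              (\<lambda>\<omega>. (norm (sg i t l \<omega> - grad (Fi i) (y i t l \<omega>)))\<^sup>2) \<omega>
            \<le> node_var m \<phi> xs R i / real b"
    \<comment> \<open>second-order assumptions\<close>
    and C2: "\<And>i. i < n \<Longrightarrow> C2_on Bxs (Fi i)"
    and nonneg: "\<H> \<ge> 0" "M \<ge> 0"
    and hess_het: "\<And>i z. i < n \<Longrightarrow> z \<in> Bxs \<Longrightarrow>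
          norm (hess Bxs (Fi i) z - hess Bxs F z) \<le> \<H>"
    and hess_lip: "\<And>i z w. i < n \<Longrightarrow> z \<in> Bxs \<Longrightarrow> w \<in> Bxs \<Longrightarrow>
          norm (hess Bxs (Fi i) z - hess Bxs (Fi i) w) \<le> M * norm (z - w)"
  shows "(\<forall>t. g (Suc t) \<le> T_map a (g t) + 2 * \<theta> / L * K * \<Delta>sq t
              + \<theta>\<^sup>2 / (2 * L * real n * real H) * (v\<^sup>2 / real b))
       \<and> (\<forall>t. q t \<le> qbar)
       \<and> (\<forall>t. g (Suc t) \<le> g t - al * (g t)\<^sup>2 + \<beta> * g t + \<delta>)
       \<and> (\<forall>T\<ge>1. (MIN t\<in>{..<T}. g t)
              \<le> \<beta> / al + sqrt (\<delta> / al) + sqrt (g 0 / (al * real T)))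
       \<and> (\<H> = 0 \<longrightarrow> M = 0 \<longrightarrow>
            K = 0 \<and> C1_abs > 0 \<and> C2_abs > 0 \<and>
            (\<forall>T\<ge>1. (MIN t\<in>{..<T}. g t)
              \<le> C1_abs * sqrt (L * R\<^sup>2 * g 0 / (\<theta> * real T))
               + C2_abs * R * v * sqrt (\<theta> / (real n * real H * real b))))"
proof -
  note defs = Fi_def F_def Bxs_def \<eta>_def sg_def D_def \<G>_def
  interpret S: controlled_local_sgd P n m \<phi> L R xs H b \<theta> B x y c cbar
  proof (intro controlled_local_sgd.intro finite_sum_problem.intro controlled_local_sgd_axioms.intro)
    show "prob_space P" by (rule prob)
  qed (fact sizes params conv smooth init_x init_c init_c_sq batch alg_c0 alg_y0
      minimizer[unfolded defs] alg_y[unfolded defs] alg_c[unfolded defs] alg_x[unfolded defs] alg_cbar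
      confined[unfolded defs] indep[unfolded defs] unbiased[unfolded defs] variance[unfolded defs])+
  have g: "g = S.gap" by (simp add: fun_eq_iff g_def S.gap_def F_def)
  have q: "q = S.q" by (simp add: fun_eq_iff q_def S.q_def S.err_def Fi_def)
  have v2: "v\<^sup>2 = S.vsq" using S.vsq_nonneg by (simp add: v_def S.vsq_def)
  have v0: "v \<ge> 0" using S.vsq_nonneg by (simp add: v_def S.vsq_def)
  have K0: "K \<ge> 0" by (simp add: K_def)
  have nHb: "real n > 0" "real H > 0" "real b > 0" using sizes by auto
  have a0: "a > 0" and al0: "al > 0" using params by (simp_all add: a_def al_def)
  have g0: "g t \<ge> 0" for t using S.gap_nonneg by (simp add: g)
  have \<Delta>: "S.drift t \<le> \<Delta>sq t" for t
    using S.drift_le[of t] by (simp add: \<Delta>sq_def g q v2)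

  have round: "g (Suc t) \<le> T_map a (g t) + 2 * \<theta> / L * K * \<Delta>sq t
      + \<theta>\<^sup>2 / (2 * L * real n * real H) * (v\<^sup>2 / real b)" for t
  proof -
    have "g (Suc t) \<le> T_map a (g t) + \<theta> / (2 * L) * (4 * K) * S.drift t
        + \<theta>\<^sup>2 / (2 * L * real n * real H) * (v\<^sup>2 / real b)"
      unfolding g a_def v2
    proof (rule S.round_descent)
      fix l \<omega> assume good: "\<omega> \<in> space P \<and> (\<forall>t. x t \<omega> \<in> cball xs R \<and> (\<forall>i<n. \<forall>l\<le>H. y i t l \<omega> \<in> cball xs R))"
        and l: "l \<le> H"
      show "(norm ((1 / real n) *\<^sub>R (\<Sum>i<n. grad (node_obj m \<phi> i) (y i t l \<omega>))
            - grad (global_obj n m \<phi>) (S.ybar t l \<omega>)))\<^sup>2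
          \<le> 4 * K * ((1 / real n) * (\<Sum>i<n. (norm (y i t l \<omega> - x t \<omega>))\<^sup>2))"
        unfolding S.ybar_def K_def
        by (rule S.averaging_bias[OF C2[unfolded defs] nonneg(2,1) hess_het[unfolded defs]
              hess_lip[unfolded defs]]) (use good l in blast)+
    qed (use K0 in simp)
    moreover have "\<theta> / (2 * L) * (4 * K) * S.drift t \<le> \<theta> / (2 * L) * (4 * K) * \<Delta>sq t"
      using params K0 by (intro mult_left_mono \<Delta>) auto
    moreover have "\<theta> / (2 * L) * (4 * K) = 2 * \<theta> / L * K" by simp
    ultimately show ?thesis by (simp only:)
  qed

  have qb: "q t \<le> qbar" for t
    using S.q_bounded[of t] by (simp add: q qbar_def Aq_def Bq_def Cq_def fbar_def v2)

  have quad: "g (Suc t) \<le> g t - al * (g t)\<^sup>2 + \<beta> * g t + \<delta>" for t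
  proof -
    \<comment> \<open>the gap is at most \<open>fbar\<close> on the ball, which gives the factor \<open>1 + \<theta> / 4\<close> in \<open>al\<close>\<close>
    have "a * g t \<le> a * (L * R\<^sup>2 / 2)"
      using a0 S.gap_le by (intro mult_left_mono) (auto simp: g)
    also have "\<dots> = \<theta> / 4" using params by (simp add: a_def)
    finally have "T_map a (g t) \<le> g t - a / (1 + \<theta> / 4) * (g t)\<^sup>2"
      using a0 g0 by (intro T_map_le_quadratic) auto
    also have "a / (1 + \<theta> / 4) = al" by (simp add: a_def al_def)
    finally have T: "T_map a (g t) \<le> g t - al * (g t)\<^sup>2" .
    have "2 * \<theta> / L * K * \<Delta>sq t \<le> 2 * \<theta> / L * K * (96 * \<theta>\<^sup>2 / L * g t
        + 32 * \<theta>\<^sup>2 * v\<^sup>2 / (L\<^sup>2 * real H * real b) + 192 * \<theta>\<^sup>2 / L\<^sup>2 * qbar)"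
      unfolding \<Delta>sq_def using params K0 by (intro mult_left_mono add_left_mono qb) auto
    with T have "g (Suc t) \<le> g t - al * (g t)\<^sup>2 + 2 * \<theta> / L * K * (96 * \<theta>\<^sup>2 / L * g t
        + 32 * \<theta>\<^sup>2 * v\<^sup>2 / (L\<^sup>2 * real H * real b) + 192 * \<theta>\<^sup>2 / L\<^sup>2 * qbar)
        + \<theta>\<^sup>2 / (2 * L * real n * real H) * (v\<^sup>2 / real b)"
      by (intro order_trans[OF round] add_right_mono add_mono)
    also have "\<dots> = g t - al * (g t)\<^sup>2 + \<beta> * g t + \<delta>"
      by (simp only: \<beta>_def \<delta>_def distrib_left mult.assoc add.assoc)
    finally show ?thesis .
  qed

  have qbar0: "qbar \<ge> 0" using qb[of 0] S.q_nonneg[of 0] by (simp add: q)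
  have \<beta>0: "\<beta> \<ge> 0" using params K0 by (simp add: \<beta>_def)
  have \<delta>0: "\<delta> \<ge> 0" using params K0 qbar0 by (simp add: \<delta>_def)
  have min: "(MIN t\<in>{..<T}. g t) \<le> \<beta> / al + sqrt (\<delta> / al) + sqrt (g 0 / (al * real T))"
    if "T \<ge> 1" for T
    using al0 \<beta>0 \<delta>0 that g0 quad by (rule Min_le_of_quadratic_recursion)

  have hom: "(MIN t\<in>{..<T}. g t) \<le> C1_abs * sqrt (L * R\<^sup>2 * g 0 / (\<theta> * real T))
      + C2_abs * R * v * sqrt (\<theta> / (real n * real H * real b))"
    if h: "\<H> = 0" "M = 0" and T: "T \<ge> 1" for T
  proof -
    have K: "K = 0" using h by (simp add: K_def)
    have "g 0 / (al * real T) = (2 * (1 + \<theta> / 4)) * (L * R\<^sup>2 * g 0 / (\<theta> * real T))"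
      using params T by (simp add: al_def field_simps)
    also have "\<dots> \<le> 5 / 2 * (L * R\<^sup>2 * g 0 / (\<theta> * real T))"
      using params g0 by (intro mult_right_mono) auto
    finally have 1: "sqrt (g 0 / (al * real T)) \<le> C1_abs * sqrt (L * R\<^sup>2 * g 0 / (\<theta> * real T))"
      unfolding C1_abs_def real_sqrt_mult[symmetric] by (rule real_sqrt_le_mono)
    have "\<delta> / al = (1 + \<theta> / 4) * (R\<^sup>2 * v\<^sup>2 * (\<theta> / (real n * real H * real b)))"
      using params nHb K by (simp add: \<delta>_def al_def field_simps power2_eq_square)
    also have "\<dots> \<le> 5 / 4 * (R\<^sup>2 * v\<^sup>2 * (\<theta> / (real n * real H * real b)))"
      using params by (intro mult_right_mono) auto
    finally have "sqrt (\<delta> / al) \<le> sqrt (5 / 4 * (R\<^sup>2 * v\<^sup>2 * (\<theta> / (real n * real H * real b))))"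
      by (rule real_sqrt_le_mono)
    also have "\<dots> = C2_abs * R * v * sqrt (\<theta> / (real n * real H * real b))"
      using params v0 by (simp only: C2_abs_def real_sqrt_mult real_sqrt_abs abs_of_nonneg less_imp_le mult.assoc)
    finally have 2: "sqrt (\<delta> / al) \<le> C2_abs * R * v * sqrt (\<theta> / (real n * real H * real b))" .
    have "\<beta> = 0" using K by (simp add: \<beta>_def)
    then show ?thesis using min[OF T] 1 2 by simp
  qed
  have "K = 0 \<and> C1_abs > 0 \<and> C2_abs > 0" if "\<H> = 0" "M = 0"
    using that by (simp add: K_def C1_abs_def C2_abs_def)
  with round qb quad min hom show ?thesis by blast
qed

end
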